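(* (i) Each multiplicative weakly mixing operator on the $F$-algebra $C^\infty(\mathbb{R},\mathbb{C})$ over $\mathbb{K}=\mathbb{C}$ supports a dense, non-finitely generated algebra of hypercyclic vectors (with the zero vector). In particular, each translation operator $T_a$ $(0\neq a\in\mathbb{R})$ on $C^\infty(\mathbb{R},\mathbb{C})$ has this property. (ii) No multiplicative operator on the $F$-algebra $H(\Omega)$ over $\mathbb{K}=\mathbb{C}$ supports a hypercyclic algebra, where $\Omega\subset\mathbb{C}$ is a simply connected domain. (iii) No multiplicative operator on the $F$-algebra $C^\infty(\mathbb{R},\mathbb{R})$ over $\mathbb{K}=\mathbb{R}$ supports a hypercyclic algebra. (iv) No multiplicative operator on the $F$-algebra $H_{\mathbb{R}}(\mathbb{C})=\{f\in H(\mathbb{C}): f(\mathbb{R})\subset\mathbb{R}\}$ over $\mathbb{K}=\mathbb{R}$ supports a hypercyclic algebra.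
   Context: For $\mathbb{F}\in\{\mathbb{R},\mathbb{C}\}$, $C^\infty(\mathbb{R},\mathbb{F})$ is the algebra of $\mathbb{F}$-valued smooth functions on the real line with pointwise product and the topology given by the seminorms $p_n(f)=\sup_{|x|\le n}\max_{0\le j\le n}|f^{(j)}(x)|$, $n\in\mathbb{N}$. $H(\Omega)$ is the algebra of holomorphic functions on the nonempty open set $\Omega$ with pointwise product and the compact-open topology; $H_{\mathbb{R}}(\mathbb{C})$ carries the topology induced from $H(\mathbb{C})$. An $F$-algebra is a metrizable and complete topological algebra. The translation operator is $T_af(x)=f(x+a)$. An operator on a $\mathbb{K}$-algebra $X$ is a continuous $\mathbb{K}$-linear map $T:X\to X$; it is multiplicative if $T(fg)=T(f)T(g)$ for all $f,g\in X$, and weakly mixing if $T\oplus T$ is hypercyclic on $X\times X$. A vector $f$ is hypercyclic for $T$ if $\{f,Tf,T^2f,\dots\}$ is dense in $X$; $T$ is hypercyclic if it has a hypercyclic vector. A hypercyclic algebra for $T$ (equivalently, an algebra of hypercyclic vectors) is a nonzero subalgebra of $X$ (not required to contain the unit) all of whose nonzero elements are hypercyclic for $T$. *)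

theory Defs
  imports "HOL-Analysis.Analysis"
begin

section \<open>Function algebras and their operators\<close>

text \<open>
  A function algebra is given by a topology \<open>X\<close> on a set of functions, the algebra itself being
  \<open>topspace X\<close>, with pointwise operations. The scalar field is a subfield \<open>K\<close> of the field of
  values, so that a real algebra of complex-valued functions is covered by \<open>K = \<real>\<close>.
  An operator is a HOL function on all functions; only its values on \<open>topspace X\<close> matter.
\<close>

definition operator_on ::
  "'f::field set \<Rightarrow> ('a \<Rightarrow> 'f) topology \<Rightarrow> (('a \<Rightarrow> 'f) \<Rightarrow> ('a \<Rightarrow> 'f)) \<Rightarrow> bool" where
  "operator_on K X T \<longleftrightarrow>
     continuous_map X X T \<and>
     (\<forall>f\<in>topspace X. \<forall>g\<in>topspace X. T (\<lambda>x. f x + g x) = (\<lambda>x. T f x + T g x)) \<and>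
     (\<forall>c\<in>K. \<forall>f\<in>topspace X. T (\<lambda>x. c * f x) = (\<lambda>x. c * T f x))"

definition multiplicative_operator ::
  "'f::field set \<Rightarrow> ('a \<Rightarrow> 'f) topology \<Rightarrow> (('a \<Rightarrow> 'f) \<Rightarrow> ('a \<Rightarrow> 'f)) \<Rightarrow> bool" where
  "multiplicative_operator K X T \<longleftrightarrow>
     operator_on K X T \<and>
     (\<forall>f\<in>topspace X. \<forall>g\<in>topspace X. T (\<lambda>x. f x * g x) = (\<lambda>x. T f x * T g x))"

definition hypercyclic_vector :: "'v topology \<Rightarrow> ('v \<Rightarrow> 'v) \<Rightarrow> 'v \<Rightarrow> bool" where
  "hypercyclic_vector X T v \<longleftrightarrow>
     v \<in> topspace X \<and> X closure_of (range (\<lambda>n. (T ^^ n) v)) = topspace X"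

definition hypercyclic :: "'v topology \<Rightarrow> ('v \<Rightarrow> 'v) \<Rightarrow> bool" where
  "hypercyclic X T \<longleftrightarrow> (\<exists>v. hypercyclic_vector X T v)"

definition weakly_mixing :: "'v topology \<Rightarrow> ('v \<Rightarrow> 'v) \<Rightarrow> bool" where
  "weakly_mixing X T \<longleftrightarrow> hypercyclic (prod_topology X X) (map_prod T T)"

text \<open>Subalgebras need not contain the constant function 1.\<close>

definition fun_subalgebra ::
  "'f::field set \<Rightarrow> ('a \<Rightarrow> 'f) topology \<Rightarrow> ('a \<Rightarrow> 'f) set \<Rightarrow> bool" where
  "fun_subalgebra K X A \<longleftrightarrow>
     A \<subseteq> topspace X \<and> (\<lambda>x. 0) \<in> A \<and>
     (\<forall>f\<in>A. \<forall>g\<in>A. (\<lambda>x. f x + g x) \<in> A) \<and>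
     (\<forall>c\<in>K. \<forall>f\<in>A. (\<lambda>x. c * f x) \<in> A) \<and>
     (\<forall>f\<in>A. \<forall>g\<in>A. (\<lambda>x. f x * g x) \<in> A)"

definition finitely_generated_subalgebra ::
  "'f::field set \<Rightarrow> ('a \<Rightarrow> 'f) topology \<Rightarrow> ('a \<Rightarrow> 'f) set \<Rightarrow> bool" where
  "finitely_generated_subalgebra K X A \<longleftrightarrow>
     (\<exists>S. finite S \<and> S \<subseteq> A \<and> fun_subalgebra K X hull S = A)"

definition hypercyclic_algebra ::
  "'f::field set \<Rightarrow> ('a \<Rightarrow> 'f) topology \<Rightarrow> (('a \<Rightarrow> 'f) \<Rightarrow> ('a \<Rightarrow> 'f)) \<Rightarrow> ('a \<Rightarrow> 'f) set \<Rightarrow> bool" where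
  "hypercyclic_algebra K X T A \<longleftrightarrow>
     fun_subalgebra K X A \<and> A \<noteq> {\<lambda>x. 0} \<and>
     (\<forall>f\<in>A. f \<noteq> (\<lambda>x. 0) \<longrightarrow> hypercyclic_vector X T f)"


section \<open>Smooth functions on the real line\<close>

definition nth_deriv :: "nat \<Rightarrow> (real \<Rightarrow> 'f::real_normed_vector) \<Rightarrow> real \<Rightarrow> 'f" where
  "nth_deriv j = (\<lambda>f x. vector_derivative f (at x)) ^^ j"

definition smooth_funs :: "(real \<Rightarrow> 'f::real_normed_vector) set" where
  "smooth_funs = {f. \<forall>j x. nth_deriv j f differentiable (at x)}"

definition smooth_seminorm :: "nat \<Rightarrow> (real \<Rightarrow> 'f::real_normed_vector) \<Rightarrow> real" where
  "smooth_seminorm n f =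
     (SUP x\<in>{- real n..real n}. Max ((\<lambda>j. norm (nth_deriv j f x)) ` {0..n}))"

definition smooth_topology :: "(real \<Rightarrow> 'f::real_normed_vector) topology" where
  "smooth_topology = topology_generated_by
     {{g \<in> smooth_funs. smooth_seminorm n (\<lambda>x. g x - f x) < e} | f n e. f \<in> smooth_funs \<and> e > 0}"

definition translation :: "real \<Rightarrow> (real \<Rightarrow> 'f) \<Rightarrow> (real \<Rightarrow> 'f)" where
  "translation a f = (\<lambda>x. f (x + a))"

lemma nth_deriv_zero: "nth_deriv j (\<lambda>x. 0 :: 'f::real_normed_vector) = (\<lambda>x. 0)"
  by (induction j) (simp_all add: nth_deriv_def)

lemma topspace_smooth_topology: "topspace smooth_topology = smooth_funs"
proof -
  have "smooth_seminorm n (\<lambda>x. f x - f x) < (1::real)" for n and f :: "real \<Rightarrow> 'a"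
  proof -
    have "(\<lambda>j. norm (nth_deriv j (\<lambda>x. f x - f x) x)) ` {0..n} = {0}" for x
      by (auto simp: nth_deriv_zero)
    then show ?thesis by (simp add: smooth_seminorm_def)
  qed
  then have "f \<in> topspace smooth_topology" if "f \<in> smooth_funs" for f :: "real \<Rightarrow> 'a"
    unfolding smooth_topology_def topology_generated_by_topspace
    using that
    by (intro UnionI[of "{g \<in> smooth_funs. smooth_seminorm 0 (\<lambda>x. g x - f x) < 1}"] CollectI
          exI[of _ f] exI[of _ "0::nat"] exI[of _ "1::real"] conjI refl) simp_all
  moreover have "topspace smooth_topology \<subseteq> (smooth_funs :: (real \<Rightarrow> 'a) set)"
    unfolding smooth_topology_def topology_generated_by_topspace by (rule Union_least) auto
  ultimately show ?thesis by blast
qed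


section \<open>Holomorphic functions\<close>

text \<open>
  Functions on \<open>\<Omega>\<close> are represented by their extension by 0, so that equality of functions is
  equality on \<open>\<Omega>\<close> and the pointwise operations stay inside the carrier.
\<close>

definition hol_funs :: "complex set \<Rightarrow> (complex \<Rightarrow> complex) set" where
  "hol_funs \<Omega> = {f. f holomorphic_on \<Omega> \<and> (\<forall>z. z \<notin> \<Omega> \<longrightarrow> f z = 0)}"

definition hol_topology :: "complex set \<Rightarrow> (complex \<Rightarrow> complex) topology" where
  "hol_topology \<Omega> = topology_generated_by
     {{f \<in> hol_funs \<Omega>. f ` C \<subseteq> U} | C U. compact C \<and> C \<subseteq> \<Omega> \<and> open U}"

definition real_entire_topology :: "(complex \<Rightarrow> complex) topology" where
  "real_entire_topology = subtopology (hol_topology UNIV) {f. f ` \<real> \<subseteq> \<real>}"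

lemma topspace_hol_topology: "topspace (hol_topology \<Omega>) = hol_funs \<Omega>"
proof -
  have "hol_funs \<Omega> \<in> {{f \<in> hol_funs \<Omega>. f ` C \<subseteq> U} | C U. compact C \<and> C \<subseteq> \<Omega> \<and> open U}"
    by (intro CollectI exI[of _ "{}"] conjI) auto
  then have "hol_funs \<Omega> \<subseteq> topspace (hol_topology \<Omega>)"
    unfolding hol_topology_def topology_generated_by_topspace by (rule Union_upper)
  moreover have "topspace (hol_topology \<Omega>) \<subseteq> hol_funs \<Omega>"
    unfolding hol_topology_def topology_generated_by_topspace by (rule Union_least) auto
  ultimately show ?thesis by (rule equalityI[rotated])
qed

lemma topspace_real_entire_topology:
  "topspace real_entire_topology = {f. f holomorphic_on UNIV \<and> f ` \<real> \<subseteq> \<real>}"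
  by (auto simp: real_entire_topology_def topspace_hol_topology hol_funs_def)

end

theory Submission
  imports Defs "HOL-Complex_Analysis.Complex_Analysis"
    "HOL-Computational_Algebra.Fundamental_Theorem_Algebra"
begin

text \<open>
  The two halves of the theorem rest on the same observation. A multiplicative operator \<open>T\<close>
  commutes with polynomial maps without constant term, so the orbit of \<open>p(f)\<close> is the image under \<open>p\<close> of the orbit
  of \<open>f\<close>. Whether hypercyclic algebras exist is thus a question about the range of polynomial maps
  on the function algebra.

  \<^bold>\<open>Non-existence.\<close> If \<open>f\<close> is a nonzero element of a hypercyclic algebra, then so is \<open>f\<^sup>2\<close>, and its orbit
  consists of squares. Squares are not dense in the three algebras concerned
  (\<open>no_hypercyclic_algebra_if_squares_not_dense\<close>): squares of real functions stay away from \<open>-1\<close>,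
  and a square of a holomorphic function has only multiple zeros, so that it stays away from a
  function with a simple zero (\<open>square_not_near_simple_zero\<close>).

  \<^bold>\<open>Existence.\<close> On complex-valued smooth functions every nonconstant polynomial \<open>p\<close> has dense range
  (\<open>poly_range_dense\<close>). Indeed the image of a smooth curve is a null set in the plane, so a smooth \<open>g\<close> can be
  moved by a small constant until it avoids the finitely many critical values of \<open>p\<close>. Off the
  critical values \<open>p\<close> is a covering map, and the simply connected line lifts.

  Weak mixing of \<open>T\<close> is inherited by all finite powers \<open>T \<times> \<dots> \<times> T\<close> (\<open>pairwise_transitive_finite\<close>), and the
  Baire category theorem in the sequence space \<open>X\<^sup>\<nat>\<close> then gives a sequence \<open>f\<^sub>0, f\<^sub>1, \<dots>\<close> that is dense in \<open>X\<close> and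
  has a dense orbit under the coordinatewise action of \<open>T\<close> (\<open>dense_orbit_in_sequence_space\<close>). The
  algebra it generates is the one sought. Let \<open>\<phi>\<close> be a polynomial in finitely many variables, not zero
  and without constant term. Restricted to a suitable line through the origin it is a nonconstant
  polynomial in one variable, so that \<open>\<phi>\<close> has dense range on \<open>X\<^sup>\<nat>\<close>; being continuous, \<open>\<phi>\<close> maps the dense
  orbit of the sequence onto a dense set, which is the orbit of \<open>\<phi>(f\<^sub>0, f\<^sub>1, \<dots>)\<close> (\<open>poly_map_hypercyclic\<close>). The
  same density shows that no \<open>f\<^sub>N\<close> is a polynomial in the earlier members
  (\<open>generator_not_in_previous\<close>), which excludes a finite set of generators.

  Translations are covered because they are mixing: the products of polynomials with a Gaussian are dense, and
  their translates tend to \<open>0\<close> in both directions (\<open>translation_mixing\<close>).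
\<close>

section \<open>Smooth functions and their derivatives\<close>

lemma nth_deriv_0 [simp]: "nth_deriv 0 f = f"
  by (simp add: nth_deriv_def)

lemma nth_deriv_Suc: "nth_deriv (Suc j) f = nth_deriv j (\<lambda>x. vector_derivative f (at x))"
  by (simp add: nth_deriv_def funpow_Suc_right del: funpow.simps)

lemma nth_deriv_Suc':
  "nth_deriv (Suc j) f = (\<lambda>x. vector_derivative (nth_deriv j f) (at x))"
  by (simp add: nth_deriv_def)

lemma vector_derivative_ext:
  assumes "\<And>x. (f has_vector_derivative f' x) (at x)"
  shows "(\<lambda>x. vector_derivative f (at x)) = f'"
  using assms by (auto intro: vector_derivative_at)

primrec times_differentiable :: "nat \<Rightarrow> (real \<Rightarrow> 'f::real_normed_vector) \<Rightarrow> bool" where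
  "times_differentiable 0 f \<longleftrightarrow> True"
| "times_differentiable (Suc k) f \<longleftrightarrow>
     (\<forall>x. f differentiable at x) \<and> times_differentiable k (\<lambda>x. vector_derivative f (at x))"

lemma times_differentiable_iff:
  "times_differentiable k f \<longleftrightarrow> (\<forall>j<k. \<forall>x. nth_deriv j f differentiable at x)"
proof (induction k arbitrary: f)
  case (Suc k)
  then show ?case
    by (simp add: All_less_Suc2 nth_deriv_Suc)
qed auto

lemma smooth_funs_iff: "f \<in> smooth_funs \<longleftrightarrow> (\<forall>k. times_differentiable k f)"
  by (auto simp: smooth_funs_def times_differentiable_iff)

text \<open>
  Together with the elimination rule below, this turns closure properties of smooth functions into
  inductions on the order: the derivative of a sum, product, inverse or lift is an expression in
  functions for which the induction hypothesis is available.
\<close>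

lemma times_differentiable_SucI:
  assumes "\<And>x. (f has_vector_derivative f' x) (at x)" "times_differentiable k f'"
  shows "times_differentiable (Suc k) f"
  using assms vector_derivative_ext[OF assms(1)] by (auto intro: differentiableI_vector)

lemma times_differentiable_SucE:
  assumes "times_differentiable (Suc k) f"
  obtains f' where "\<And>x. (f has_vector_derivative f' x) (at x)" "times_differentiable k f'"
  using assms that[of "\<lambda>x. vector_derivative f (at x)"] by (simp add: vector_derivative_works[symmetric])

lemma times_differentiable_Suc_imp: "times_differentiable (Suc k) f \<Longrightarrow> times_differentiable k f"
  by (simp add: times_differentiable_iff)

lemma times_differentiable_const [simp]: "times_differentiable k (\<lambda>x. c)"
proof (induction k arbitrary: c)
  case (Suc k)
  show ?case by (rule times_differentiable_SucI[where f' = "\<lambda>x. 0"]) (auto intro: Suc)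
qed auto

lemma times_differentiable_add:
  "times_differentiable k f \<Longrightarrow> times_differentiable k g \<Longrightarrow> times_differentiable k (\<lambda>x. f x + g x)"
proof (induction k arbitrary: f g)
  case (Suc k)
  from Suc.prems(1) obtain f' where f: "\<And>x. (f has_vector_derivative f' x) (at x)" "times_differentiable k f'"
    by (rule times_differentiable_SucE) (rule that)
  from Suc.prems(2) obtain g' where g: "\<And>x. (g has_vector_derivative g' x) (at x)" "times_differentiable k g'"
    by (rule times_differentiable_SucE) (rule that)
  show ?case
    by (rule times_differentiable_SucI[OF has_vector_derivative_add[OF f(1) g(1)]]) (intro Suc.IH f g)
qed auto

lemma times_differentiable_mult:
  fixes f g :: "real \<Rightarrow> 'f::real_normed_algebra"
  shows "times_differentiable k f \<Longrightarrow> times_differentiable k g \<Longrightarrow> times_differentiable k (\<lambda>x. f x * g x)"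
proof (induction k arbitrary: f g)
  case (Suc k)
  from Suc.prems(1) obtain f' where f: "\<And>x. (f has_vector_derivative f' x) (at x)" "times_differentiable k f'"
    by (rule times_differentiable_SucE) (rule that)
  from Suc.prems(2) obtain g' where g: "\<And>x. (g has_vector_derivative g' x) (at x)" "times_differentiable k g'"
    by (rule times_differentiable_SucE) (rule that)
  show ?case
    by (rule times_differentiable_SucI[OF has_vector_derivative_mult[OF f(1) g(1)]])
      (intro times_differentiable_add Suc.IH f g Suc.prems[THEN times_differentiable_Suc_imp])
qed auto

lemma times_differentiable_inverse:
  fixes f :: "real \<Rightarrow> 'f::real_normed_field"
  assumes "\<And>x. f x \<noteq> 0"
  shows "times_differentiable k f \<Longrightarrow> times_differentiable k (\<lambda>x. inverse (f x))"
proof (induction k)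
  case (Suc k)
  from Suc.prems(1) obtain f' where f: "\<And>x. (f has_vector_derivative f' x) (at x)" "times_differentiable k f'"
    by (rule times_differentiable_SucE) (rule that)
  have IH: "times_differentiable k (\<lambda>x. inverse (f x))"
    by (rule Suc.IH[OF times_differentiable_Suc_imp[OF Suc.prems]])
  have "((\<lambda>x. inverse (f x)) has_vector_derivative (-1 * (inverse (f x) * f' x * inverse (f x)))) (at x)" for x
    using Deriv.has_derivative_inverse[OF assms f(1)[of x, unfolded has_vector_derivative_def]]
    by (simp add: has_vector_derivative_def)
  then show ?case
    by (rule times_differentiable_SucI) (intro times_differentiable_mult IH f times_differentiable_const)
qed auto

lemma has_vector_derivative_translation:
  assumes "\<And>x. (f has_vector_derivative f' x) (at x)"
  shows "(translation a f has_vector_derivative translation a f' x) (at x)"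
proof -
  have "((\<lambda>x. x + a) has_vector_derivative 1) (at x)"
    by (auto intro!: derivative_eq_intros)
  from vector_diff_chain_at[OF this assms] show ?thesis
    by (simp add: translation_def o_def)
qed

lemma times_differentiable_translation:
  "times_differentiable k f \<Longrightarrow> times_differentiable k (translation a f)"
proof (induction k arbitrary: f)
  case (Suc k)
  from Suc.prems(1) obtain f' where f: "\<And>x. (f has_vector_derivative f' x) (at x)" "times_differentiable k f'"
    by (rule times_differentiable_SucE) (rule that)
  have "(translation a f has_vector_derivative translation a f' x) (at x)" for x
    by (intro has_vector_derivative_translation f)
  then show ?case
    by (rule times_differentiable_SucI) (intro Suc.IH f)
qed auto

lemma times_differentiable_of_real [simp]:
 "times_differentiable k (of_real :: real \<Rightarrow> 'f::real_normed_algebra_1)"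
  by (cases k) (auto intro!: times_differentiable_SucI[where f' = "\<lambda>x. 1"] derivative_eq_intros)

lemma times_differentiable_poly:
  fixes f :: "real \<Rightarrow> 'f::real_normed_field"
  assumes "times_differentiable k f"
  shows "times_differentiable k (\<lambda>x. poly p (f x))"
  by (induction p) (auto intro!: times_differentiable_add times_differentiable_mult assms)

lemma smooth_const [simp]: "(\<lambda>x. c) \<in> smooth_funs"
  by (simp add: smooth_funs_iff)

lemma smooth_add: "f \<in> smooth_funs \<Longrightarrow> g \<in> smooth_funs \<Longrightarrow> (\<lambda>x. f x + g x) \<in> smooth_funs"
  by (simp add: smooth_funs_iff times_differentiable_add)

lemma smooth_mult:
  fixes f g :: "real \<Rightarrow> 'f::real_normed_algebra"
  shows "f \<in> smooth_funs \<Longrightarrow> g \<in> smooth_funs \<Longrightarrow> (\<lambda>x. f x * g x) \<in> smooth_funs"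
  by (simp add: smooth_funs_iff times_differentiable_mult)

lemma smooth_translation: "f \<in> smooth_funs \<Longrightarrow> translation a f \<in> smooth_funs"
  by (simp add: smooth_funs_iff times_differentiable_translation)

lemma smooth_poly: "f \<in> smooth_funs \<Longrightarrow> (\<lambda>x. poly p (f x)) \<in> smooth_funs"
  for f :: "real \<Rightarrow> 'f::real_normed_field"
  by (simp add: smooth_funs_iff times_differentiable_poly)

lemma smooth_of_real [simp]: "(of_real :: real \<Rightarrow> 'f::real_normed_algebra_1) \<in> smooth_funs"
  by (simp add: smooth_funs_iff)

lemma smooth_has_vector_derivative:
  "f \<in> smooth_funs \<Longrightarrow> (nth_deriv j f has_vector_derivative nth_deriv (Suc j) f x) (at x)"
  by (simp add: smooth_funs_def nth_deriv_Suc' vector_derivative_works[symmetric])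

lemma smooth_nth_deriv: "f \<in> smooth_funs \<Longrightarrow> nth_deriv j f \<in> smooth_funs"
  by (simp add: smooth_funs_def nth_deriv_def flip: funpow_add o_apply[of "_ ^^ _"])

lemma smooth_continuous: "f \<in> smooth_funs \<Longrightarrow> continuous_on A (nth_deriv j f)"
  by (auto simp: smooth_funs_def intro!: continuous_at_imp_continuous_on differentiable_imp_continuous_within)

lemma nth_deriv_add:
  assumes "f \<in> smooth_funs" "g \<in> smooth_funs"
  shows "nth_deriv j (\<lambda>x. f x + g x) = (\<lambda>x. nth_deriv j f x + nth_deriv j g x)"
proof (induction j)
  case (Suc j)
  show ?case unfolding nth_deriv_Suc'[of _ "\<lambda>x. f x + g x"] Suc
    by (intro vector_derivative_ext has_vector_derivative_add smooth_has_vector_derivative assms)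
qed auto

lemma nth_deriv_minus:
  assumes "f \<in> smooth_funs"
  shows "nth_deriv j (\<lambda>x. - f x) = (\<lambda>x. - nth_deriv j f x)"
proof (induction j)
  case (Suc j)
  show ?case unfolding nth_deriv_Suc'[of _ "\<lambda>x. - f x"] Suc
    by (intro vector_derivative_ext has_vector_derivative_minus smooth_has_vector_derivative assms)
qed auto

lemma smooth_minus: "f \<in> smooth_funs \<Longrightarrow> (\<lambda>x. - f x) \<in> smooth_funs"
  by (auto simp: smooth_funs_def nth_deriv_minus)

lemma smooth_diff: "f \<in> smooth_funs \<Longrightarrow> g \<in> smooth_funs \<Longrightarrow> (\<lambda>x. f x - g x) \<in> smooth_funs"
  using smooth_add[OF _ smooth_minus] by simp

lemma nth_deriv_diff:
  assumes "f \<in> smooth_funs" "g \<in> smooth_funs"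
  shows "nth_deriv j (\<lambda>x. f x - g x) = (\<lambda>x. nth_deriv j f x - nth_deriv j g x)"
  using nth_deriv_add[OF assms(1) smooth_minus[OF assms(2)]] by (simp add: nth_deriv_minus assms)

lemma nth_deriv_translation:
  assumes "f \<in> smooth_funs"
  shows "nth_deriv j (translation a f) = translation a (nth_deriv j f)"
proof (induction j)
  case (Suc j)
  show ?case unfolding nth_deriv_Suc'[of _ "translation a f"] Suc
  proof (rule vector_derivative_ext)
    show "(translation a (nth_deriv j f) has_vector_derivative translation a (nth_deriv (Suc j) f) x) (at x)" for x
      by (intro has_vector_derivative_translation smooth_has_vector_derivative assms)
  qed
qed auto

lemma nth_deriv_const: "nth_deriv j (\<lambda>x. c) = (\<lambda>x. if j = 0 then c else 0)"
  by (cases j) (simp_all add: nth_deriv_Suc nth_deriv_zero)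

text \<open>
  The conditions \<open>p\<^sub>n(h) \<le> e\<close> on the defining seminorms, with the order \<open>j\<close> of differentiation and the
  radius \<open>r\<close> separated. The separation is what permits induction on the order.
\<close>

definition deriv_bound :: "nat \<Rightarrow> real \<Rightarrow> (real \<Rightarrow> 'f::real_normed_vector) \<Rightarrow> real \<Rightarrow> bool" where
  "deriv_bound j r h e \<longleftrightarrow> (\<forall>i\<le>j. \<forall>x. \<bar>x\<bar> \<le> r \<longrightarrow> norm (nth_deriv i h x) \<le> e)"

lemma deriv_bound_Suc:
  "deriv_bound (Suc j) r h e \<longleftrightarrow>
     (\<forall>x. \<bar>x\<bar> \<le> r \<longrightarrow> norm (h x) \<le> e) \<and> deriv_bound j r (\<lambda>x. vector_derivative h (at x)) e"
  unfolding deriv_bound_def less_Suc_eq_le[symmetric] All_less_Suc2[of "Suc j"] by (simp add: nth_deriv_Suc)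

lemma deriv_bound_mono:
  "deriv_bound j r h e \<Longrightarrow> i \<le> j \<Longrightarrow> s \<le> r \<Longrightarrow> e \<le> d \<Longrightarrow> deriv_bound i s h d"
  unfolding deriv_bound_def by (meson order_trans)

lemma deriv_bound_add:
  assumes "f \<in> smooth_funs" "g \<in> smooth_funs" "deriv_bound j r f a" "deriv_bound j r g b"
  shows "deriv_bound j r (\<lambda>x. f x + g x) (a + b)"
  using assms unfolding deriv_bound_def by (auto simp: nth_deriv_add intro!: norm_triangle_le add_mono)

lemma deriv_bound_minus: "f \<in> smooth_funs \<Longrightarrow> deriv_bound j r (\<lambda>x. - f x) e \<longleftrightarrow> deriv_bound j r f e"
  by (simp add: deriv_bound_def nth_deriv_minus)

lemma deriv_bound_triangle:
  assumes "f \<in> smooth_funs" "g \<in> smooth_funs" "h \<in> smooth_funs"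
    "deriv_bound j r (\<lambda>x. f x - g x) a" "deriv_bound j r (\<lambda>x. g x - h x) b"
  shows "deriv_bound j r (\<lambda>x. f x - h x) (a + b)"
  using deriv_bound_add[OF smooth_diff[OF assms(1,2)] smooth_diff[OF assms(2,3)] assms(4,5)] by simp

text \<open>
  The factor \<open>2 ^ j\<close> counts the terms of the \<open>j\<close>-fold Leibniz rule; each derivative of a product is a sum
  of two products to which the induction hypothesis applies.
\<close>

lemma deriv_bound_mult:
  fixes f g :: "real \<Rightarrow> 'f::real_normed_algebra"
  assumes "f \<in> smooth_funs" "g \<in> smooth_funs" "deriv_bound j r f a" "deriv_bound j r g b" "0 \<le> a" "0 \<le> b"
  shows "deriv_bound j r (\<lambda>x. f x * g x) (2 ^ j * a * b)"
  using assms
proof (induction j arbitrary: f g)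
  case 0
  then show ?case by (auto simp: deriv_bound_def intro!: order_trans[OF norm_mult_ineq] mult_mono)
next
  case (Suc j)
  let ?D = "\<lambda>f x. vector_derivative f (at x)"
  have D: "?D f \<in> smooth_funs" if "f \<in> smooth_funs" for f :: "real \<Rightarrow> 'f"
    using smooth_nth_deriv[OF that, of 1] by (simp add: nth_deriv_def)
  have d: "(f has_vector_derivative ?D f x) (at x)" if "f \<in> smooth_funs" for f :: "real \<Rightarrow> 'f" and x
    using smooth_has_vector_derivative[OF that, of 0] by (simp add: nth_deriv_def)
  note S = Suc.prems
  note b = S(3,4)[unfolded deriv_bound_Suc]
  have e: "?D (\<lambda>x. f x * g x) = (\<lambda>x. f x * ?D g x + ?D f x * g x)"
    by (intro vector_derivative_ext has_vector_derivative_mult d S)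
  have "deriv_bound j r (\<lambda>x. f x * ?D g x + ?D f x * g x) (2 ^ j * a * b + 2 ^ j * a * b)"
    using S b by (intro deriv_bound_add Suc.IH smooth_mult D)
      (auto intro: deriv_bound_mono[OF S(3)] deriv_bound_mono[OF S(4)])
  moreover have "norm (f x * g x) \<le> 2 ^ Suc j * a * b" if "\<bar>x\<bar> \<le> r" for x
  proof -
    have "norm (f x * g x) \<le> a * b"
      using that b S by (auto intro!: order_trans[OF norm_mult_ineq] mult_mono)
    also have "\<dots> \<le> 2 ^ Suc j * a * b"
      using S mult_right_mono[OF one_le_power[of "2 :: real" "Suc j"], of "a * b"] by (simp add: mult.assoc)
    finally show ?thesis .
  qed
  moreover have "2 ^ j * a * b + 2 ^ j * a * b = 2 ^ Suc j * a * b"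
    by simp
  ultimately show ?case by (simp only: deriv_bound_Suc e) blast
qed

lemma deriv_bound_exists:
  assumes "f \<in> smooth_funs"
  obtains c where "0 \<le> c" "deriv_bound j r f c"
proof -
  have "\<exists>c. \<forall>x. \<bar>x\<bar> \<le> r \<longrightarrow> norm (nth_deriv i f x) \<le> c" for i
  proof -
    have "compact (nth_deriv i f ` {-r..r})"
      by (intro compact_continuous_image smooth_continuous assms compact_Icc)
    then obtain c where "\<forall>y\<in>nth_deriv i f ` {-r..r}. norm y \<le> c"
      using compact_imp_bounded bounded_iff by blast
    then show ?thesis by (intro exI[of _ c]) (simp add: abs_le_iff)
  qed
  then obtain c where c: "\<And>i x. \<bar>x\<bar> \<le> r \<Longrightarrow> norm (nth_deriv i f x) \<le> c i" by metis
  have "norm (nth_deriv i f x) \<le> (\<Sum>i\<le>j. \<bar>c i\<bar>)" if "i \<le> j" "\<bar>x\<bar> \<le> r" for i x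
  proof -
    have "norm (nth_deriv i f x) \<le> \<bar>c i\<bar>" using c[OF that(2), of i] by linarith
    also have "\<dots> \<le> (\<Sum>i\<le>j. \<bar>c i\<bar>)" using that by (intro member_le_sum) auto
    finally show ?thesis .
  qed
  then show ?thesis by (intro that[of "\<Sum>i\<le>j. \<bar>c i\<bar>"]) (auto simp: deriv_bound_def sum_nonneg)
qed

section \<open>The topology of smooth functions and its complete metric\<close>

text \<open>
  The supremum in the seminorm is over a compact interval, hence finite; this is what allows the
  passage from the supremum to the pointwise bounds.
\<close>

lemma smooth_seminorm_le_iff:
  assumes "f \<in> smooth_funs"
  shows "smooth_seminorm n f \<le> e \<longleftrightarrow> deriv_bound n (real n) f e"
proof -
  obtain c where c: "deriv_bound n (real n) f c"
    using deriv_bound_exists[OF assms] by blast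
  have "smooth_seminorm n f \<le> e \<longleftrightarrow>
      (\<forall>x\<in>{- real n..real n}. Max ((\<lambda>j. norm (nth_deriv j f x)) ` {0..n}) \<le> e)"
    unfolding smooth_seminorm_def
  proof (rule cSUP_le_iff)
    show "bdd_above ((\<lambda>x. Max ((\<lambda>j. norm (nth_deriv j f x)) ` {0..n})) ` {- real n..real n})"
      using c by (intro bdd_aboveI[where M = c]) (auto simp: deriv_bound_def abs_le_iff)
  qed auto
  also have "\<dots> \<longleftrightarrow> deriv_bound n (real n) f e"
    by (auto simp: deriv_bound_def abs_le_iff)
  finally show ?thesis .
qed

lemma smooth_seminorm_bound: "f \<in> smooth_funs \<Longrightarrow> deriv_bound n (real n) f (smooth_seminorm n f)"
  by (simp flip: smooth_seminorm_le_iff)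

text \<open>
  Closed balls of the seminorms. They form neighbourhood bases, and working with them avoids
  suprema.
\<close>

definition smooth_nbhd :: "nat \<Rightarrow> real \<Rightarrow> (real \<Rightarrow> 'f::real_normed_vector) \<Rightarrow> (real \<Rightarrow> 'f) set" where
  "smooth_nbhd n e f = {g \<in> smooth_funs. deriv_bound n (real n) (\<lambda>x. g x - f x) e}"

lemma smooth_nbhd_mono: "m \<le> n \<Longrightarrow> d \<le> e \<Longrightarrow> smooth_nbhd n d f \<subseteq> smooth_nbhd m e f"
  by (auto simp: smooth_nbhd_def intro: deriv_bound_mono)

lemma smooth_nbhd_self: "f \<in> smooth_funs \<Longrightarrow> 0 \<le> e \<Longrightarrow> f \<in> smooth_nbhd n e f"
  by (auto simp: smooth_nbhd_def deriv_bound_def nth_deriv_zero)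

lemma smooth_nbhd_open:
  assumes "f \<in> smooth_funs" "0 < e"
  obtains W where "openin smooth_topology W" "f \<in> W" "W \<subseteq> smooth_nbhd n e f"
proof
  let ?W = "{g \<in> smooth_funs. smooth_seminorm n (\<lambda>x. g x - f x) < e}"
  show "openin smooth_topology ?W"
    unfolding smooth_topology_def by (rule topology_generated_by_Basis) (use assms in blast)
  have "smooth_seminorm n (\<lambda>x. f x - f x) \<le> 0"
    by (subst smooth_seminorm_le_iff) (auto simp: deriv_bound_def nth_deriv_zero)
  then show "f \<in> ?W" using assms by simp
  show "?W \<subseteq> smooth_nbhd n e f"
    unfolding smooth_nbhd_def
    by (auto simp: smooth_seminorm_le_iff[symmetric] smooth_diff assms)
qed

text \<open>
  The topology is given by a subbase of open seminorm balls. Since the seminorms increase with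
  \<open>n\<close>, two neighbourhoods contain a common one, so single seminorm balls already form neighbourhood bases.
\<close>

lemma openin_smooth_topology:
  fixes U :: "(real \<Rightarrow> 'f::real_normed_vector) set"
  shows "openin smooth_topology U \<longleftrightarrow>
     U \<subseteq> smooth_funs \<and> (\<forall>f\<in>U. \<exists>n. \<exists>e>0. smooth_nbhd n e f \<subseteq> U)"
proof
  assume "openin smooth_topology U"
  moreover have "\<exists>n. \<exists>e>0. smooth_nbhd n e f \<subseteq> U" if "f \<in> U" for f
  proof -
    from calculation have "generate_topology_on
       {{g \<in> smooth_funs. smooth_seminorm n (\<lambda>x. g x - f x) < e} | (f :: real \<Rightarrow> 'f) n e. f \<in> smooth_funs \<and> e > 0} U"
      by (simp add: smooth_topology_def openin_topology_generated_by_iff)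
    then show ?thesis using that
    proof (induction arbitrary: f)
      case (Int A B)
      then obtain m n d e where "d > 0" "e > 0" "smooth_nbhd m d f \<subseteq> A" "smooth_nbhd n e f \<subseteq> B"
        by (metis IntE)
      then show ?case
        using smooth_nbhd_mono[of m "max m n" "min d e" d f] smooth_nbhd_mono[of n "max m n" "min d e" e f]
        by (intro exI[of _ "max m n"] exI[of _ "min d e"]) auto
    next
      case (UN K)
      then obtain k n e where "k \<in> K" "e > 0" "smooth_nbhd n e f \<subseteq> k" by (metis UnionE)
      then show ?case by blast
    next
      case (Basis S)
      then obtain g n e where g: "g \<in> smooth_funs" "e > 0" and
        S: "S = {h \<in> smooth_funs. smooth_seminorm n (\<lambda>x. h x - g x) < e}" by blast
      define d where "d = (e - smooth_seminorm n (\<lambda>x. f x - g x)) / 2"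
      have f: "f \<in> smooth_funs" "d > 0" using Basis.prems by (auto simp: S d_def)
      have "smooth_seminorm n (\<lambda>x. h x - g x) < e" if "h \<in> smooth_nbhd n d f" for h
      proof -
        have h: "h \<in> smooth_funs" "deriv_bound n n (\<lambda>x. h x - f x) d"
          using that by (auto simp: smooth_nbhd_def)
        have "smooth_seminorm n (\<lambda>x. h x - g x) \<le> d + smooth_seminorm n (\<lambda>x. f x - g x)"
          by (subst smooth_seminorm_le_iff)
            (intro smooth_diff deriv_bound_triangle[OF h(1) f(1) g(1) h(2)] smooth_seminorm_bound f g h)+
        also have "\<dots> < e" using f by (simp add: d_def field_simps)
        finally show ?thesis .
      qed
      then show ?case using f unfolding S
        by (intro exI[of _ n] exI[of _ d]) (auto simp: smooth_nbhd_def)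
    qed auto
  qed
  ultimately show "U \<subseteq> smooth_funs \<and> (\<forall>f\<in>U. \<exists>n. \<exists>e>0. smooth_nbhd n e f \<subseteq> U)"
    using openin_subset[of smooth_topology U] by (simp add: topspace_smooth_topology)
next
  assume U: "U \<subseteq> smooth_funs \<and> (\<forall>f\<in>U. \<exists>n. \<exists>e>0. smooth_nbhd n e f \<subseteq> U)"
  show "openin smooth_topology U"
  proof (subst openin_subopen, intro ballI)
    fix f assume "f \<in> U"
    with U obtain n e where "e > 0" "smooth_nbhd n e f \<subseteq> U" "f \<in> smooth_funs" by blast
    then show "\<exists>T. openin smooth_topology T \<and> f \<in> T \<and> T \<subseteq> U"
      using smooth_nbhd_open by (metis subset_trans)
  qed
qed

text \<open>
  A metric for the topology. The cut-offs \<open>1 / Suc n\<close> decrease, so that a distance below \<open>1 / Suc n\<close>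
  controls the seminorms up to \<open>n\<close>, and conversely the seminorm of index \<open>n\<close> controls the distance up
  to an error of \<open>1 / Suc n\<close>. The value \<open>0\<close> off the space keeps it symmetric and nonnegative
  also for arguments whose derivatives have no meaning.
\<close>

definition smooth_dist :: "(real \<Rightarrow> 'f::real_normed_vector) \<Rightarrow> (real \<Rightarrow> 'f) \<Rightarrow> real" where
  "smooth_dist f g =
     (if f \<in> smooth_funs \<and> g \<in> smooth_funs
      then SUP n. min (1 / real (Suc n)) (smooth_seminorm n (\<lambda>x. f x - g x)) else 0)"

lemma smooth_dist_le_iff:
  assumes "f \<in> smooth_funs" "g \<in> smooth_funs"
  shows "smooth_dist f g \<le> c \<longleftrightarrow> (\<forall>n. min (1 / real (Suc n)) (smooth_seminorm n (\<lambda>x. f x - g x)) \<le> c)"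
proof -
  have "min (1 / real (Suc n)) (smooth_seminorm n (\<lambda>x. f x - g x)) \<le> 1" for n
    by (auto simp: min_le_iff_disj)
  then have "bdd_above (range (\<lambda>n. min (1 / real (Suc n)) (smooth_seminorm n (\<lambda>x. f x - g x))))"
    by (auto intro: bdd_aboveI[where M = 1])
  then show ?thesis using assms unfolding smooth_dist_def by (simp add: cSUP_le_iff)
qed

lemma smooth_seminorm_nonneg: "f \<in> smooth_funs \<Longrightarrow> 0 \<le> smooth_seminorm n f"
  using smooth_seminorm_bound[of f n] unfolding deriv_bound_def
  by (metis norm_ge_zero order_trans abs_zero of_nat_0_le_iff order_refl)

lemma smooth_dist_ball_subset_nbhd:
  assumes "f \<in> smooth_funs" "g \<in> smooth_funs" "smooth_dist f g < min e (1 / real (Suc n))"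
  shows "g \<in> smooth_nbhd n e f"
proof -
  have "min (1 / real (Suc n)) (smooth_seminorm n (\<lambda>x. f x - g x)) \<le> smooth_dist f g"
    using smooth_dist_le_iff[OF assms(1,2), of "smooth_dist f g"] by blast
  then have "smooth_seminorm n (\<lambda>x. f x - g x) \<le> e" using assms by linarith
  then show ?thesis
    using deriv_bound_minus[OF smooth_diff[OF assms(2,1)]] smooth_diff[OF assms(1,2)] assms(2)
    by (simp add: smooth_nbhd_def smooth_seminorm_le_iff)
qed

lemma smooth_nbhd_subset_smooth_dist_ball:
  assumes "f \<in> smooth_funs" "g \<in> smooth_nbhd n (1 / real (Suc n)) f"
  shows "smooth_dist f g \<le> 1 / real (Suc n)"
proof -
  have g: "g \<in> smooth_funs" "deriv_bound n n (\<lambda>x. f x - g x) (1 / real (Suc n))"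
    using assms deriv_bound_minus[OF smooth_diff[of f g]] by (auto simp: smooth_nbhd_def)
  show ?thesis
    unfolding smooth_dist_le_iff[OF assms(1) g(1)]
  proof
    fix k
    show "min (1 / real (Suc k)) (smooth_seminorm k (\<lambda>x. f x - g x)) \<le> 1 / real (Suc n)"
    proof (cases "k \<le> n")
      case True
      then have "smooth_seminorm k (\<lambda>x. f x - g x) \<le> 1 / real (Suc n)"
        by (subst smooth_seminorm_le_iff) (auto intro: smooth_diff assms g deriv_bound_mono[OF g(2)])
      then show ?thesis by (simp add: min_le_iff_disj)
    next
      case False
      then show ?thesis by (simp add: min_le_iff_disj frac_le)
    qed
  qed
qed

lemma Metric_space_smooth: "Metric_space (smooth_funs :: (real \<Rightarrow> 'f::real_normed_vector) set) smooth_dist"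
proof
  fix f g :: "real \<Rightarrow> 'f"
  have le: "min (1 / real (Suc n)) (smooth_seminorm n (\<lambda>x. f x - g x)) \<le> smooth_dist f g"
    if "f \<in> smooth_funs" "g \<in> smooth_funs" for f g :: "real \<Rightarrow> 'f" and n
    using smooth_dist_le_iff[OF that, of "smooth_dist f g"] by blast
  have sym: "smooth_seminorm n (\<lambda>x. f x - g x) \<le> smooth_seminorm n (\<lambda>x. g x - f x)"
    if "f \<in> smooth_funs" "g \<in> smooth_funs" for n and f g :: "real \<Rightarrow> 'f"
    using smooth_seminorm_bound[OF smooth_diff[OF that(2,1)], of n] deriv_bound_minus[OF smooth_diff[OF that(2,1)]]
    by (subst smooth_seminorm_le_iff) (auto intro!: smooth_diff that)
  show nonneg: "0 \<le> smooth_dist f g"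
    using le[of f g 0] smooth_seminorm_nonneg[OF smooth_diff, of f g 0]
    by (cases "f \<in> smooth_funs \<and> g \<in> smooth_funs") (auto simp: smooth_dist_def min_def split: if_splits)
  show "smooth_dist f g = smooth_dist g f"
    using antisym[OF sym[of f g] sym[of g f]] by (auto simp: smooth_dist_def)
  show "smooth_dist f g = 0 \<longleftrightarrow> f = g" if fg: "f \<in> smooth_funs" "g \<in> smooth_funs"
  proof
    assume "f = g"
    have "min (1 / real (Suc n)) (smooth_seminorm n (\<lambda>x. f x - f x)) \<le> 0" for n
      using smooth_seminorm_le_iff[of "\<lambda>x. f x - f x" n 0]
      by (auto simp: deriv_bound_def nth_deriv_zero)
    then show "smooth_dist f g = 0"
      using nonneg \<open>f = g\<close> smooth_dist_le_iff[of f f 0] fg by auto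
  next
    assume 0: "smooth_dist f g = 0"
    show "f = g"
    proof
      fix x
      obtain n :: nat where n: "\<bar>x\<bar> \<le> real n" using real_arch_simple by blast
      have "norm (f x - g x) \<le> 0"
      proof -
        have "g \<in> smooth_nbhd n e f" if "e > 0" for e
          using that by (intro smooth_dist_ball_subset_nbhd fg) (simp add: 0)
        then have "norm (g x - f x) \<le> e" if "e > 0" for e
          using that n by (force simp: smooth_nbhd_def deriv_bound_def)
        then show ?thesis by (metis field_le_epsilon add_0 norm_minus_commute)
      qed
      then show "f x = g x" by simp
    qed
  qed
  fix h :: "real \<Rightarrow> 'f"
  assume S: "f \<in> smooth_funs" "g \<in> smooth_funs" "h \<in> smooth_funs"
  show "smooth_dist f h \<le> smooth_dist f g + smooth_dist g h"
    unfolding smooth_dist_le_iff[OF S(1,3)]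
  proof
    fix n
    have "smooth_seminorm n (\<lambda>x. f x - h x) \<le> smooth_seminorm n (\<lambda>x. f x - g x) + smooth_seminorm n (\<lambda>x. g x - h x)"
      by (subst smooth_seminorm_le_iff)
        (intro smooth_diff deriv_bound_triangle[OF S] smooth_seminorm_bound S)+
    moreover have "0 \<le> smooth_seminorm n (\<lambda>x. f x - g x)" "0 \<le> smooth_seminorm n (\<lambda>x. g x - h x)"
      by (intro smooth_seminorm_nonneg smooth_diff S)+
    ultimately show "min (1 / real (Suc n)) (smooth_seminorm n (\<lambda>x. f x - h x)) \<le> smooth_dist f g + smooth_dist g h"
      using le[OF S(1,2), of n] le[OF S(2,3), of n] divide_nonneg_nonneg[of 1 "real (Suc n)"]
      by linarith
  qed
qed

lemma smooth_topology_eq_mtopology: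
  "Metric_space.mtopology smooth_funs smooth_dist = (smooth_topology :: (real \<Rightarrow> 'f::real_normed_vector) topology)"
proof -
  interpret Metric_space "smooth_funs :: (real \<Rightarrow> 'f) set" smooth_dist by (rule Metric_space_smooth)
  have nb: "mball f (min e (1 / real (Suc n))) \<subseteq> smooth_nbhd n e f" for f :: "real \<Rightarrow> 'f" and n e
    by (auto simp: in_mball intro: smooth_dist_ball_subset_nbhd)
  have bn: "\<exists>n. \<exists>e>0. smooth_nbhd n e f \<subseteq> mball f r" if "f \<in> smooth_funs" "r > 0" for f :: "real \<Rightarrow> 'f" and r
  proof -
    obtain n where n: "1 / real (Suc n) < r" using \<open>r > 0\<close> nat_approx_posE by blast
    have "smooth_nbhd n (1 / real (Suc n)) f \<subseteq> mball f r"
      using smooth_nbhd_subset_smooth_dist_ball[OF that(1), of _ n] n that(1)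
      by (fastforce simp: in_mball smooth_nbhd_def)
    then show ?thesis by (intro exI[of _ n] exI[of _ "1 / real (Suc n)"]) simp
  qed
  have "openin mtopology U \<longleftrightarrow> openin smooth_topology U" for U :: "(real \<Rightarrow> 'f) set"
    unfolding openin_mtopology openin_smooth_topology
  proof (intro conj_cong refl iffI ballI allI impI)
    fix f assume "U \<subseteq> smooth_funs" "\<forall>x. x \<in> U \<longrightarrow> (\<exists>r>0. mball x r \<subseteq> U)" "f \<in> U"
    then show "\<exists>n. \<exists>e>0. smooth_nbhd n e f \<subseteq> U" using bn[of f] by (meson subset_iff)
  next
    fix f assume "U \<subseteq> smooth_funs" "\<forall>f\<in>U. \<exists>n. \<exists>e>0. smooth_nbhd n e f \<subseteq> U" "f \<in> U"
    then obtain n e where "e > 0" "smooth_nbhd n e f \<subseteq> U" by blast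
    then show "\<exists>r>0. mball f r \<subseteq> U"
      using nb[of f e n] by (intro exI[of _ "min e (1 / real (Suc n))"]) auto
  qed
  then show ?thesis by (simp add: topology_eq)
qed

text \<open>
  All derivatives converge uniformly on every bounded interval. Limits and derivatives can be
  exchanged under uniform convergence of the derivatives, so the limits of the derivatives are the
  derivatives of the limit.
\<close>

lemma smooth_funs_limit:
  fixes F :: "nat \<Rightarrow> real \<Rightarrow> 'f::banach"
  assumes F: "\<And>k. F k \<in> smooth_funs"
    and Cauchy: "\<And>n e. 0 < e \<Longrightarrow> \<exists>N. \<forall>k\<ge>N. \<forall>l\<ge>N. deriv_bound n (real n) (\<lambda>x. F k x - F l x) e"
  obtains f where "f \<in> smooth_funs" "\<And>n e. 0 < e \<Longrightarrow> \<exists>N. \<forall>k\<ge>N. F k \<in> smooth_nbhd n e f"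
proof -
  \<comment> \<open>the candidate for the derivative of order \<open>j\<close> of the limit\<close>
  define G where "G j x = lim (\<lambda>k. nth_deriv j (F k) x)" for j x
  have C: "\<exists>N. \<forall>k\<ge>N. \<forall>l\<ge>N. \<forall>j\<le>n. \<forall>x. \<bar>x\<bar> \<le> real n \<longrightarrow> norm (nth_deriv j (F k) x - nth_deriv j (F l) x) \<le> e"
    if "0 < e" for n e
    using Cauchy[OF that, of n] by (simp add: deriv_bound_def nth_deriv_diff F)
  have conv: "(\<lambda>k. nth_deriv j (F k) x) \<longlonglongrightarrow> G j x" for j x
  proof -
    obtain m :: nat where m: "\<bar>x\<bar> \<le> real m" using real_arch_simple by blast
    define n where "n = max m j"
    have n: "j \<le> n" "\<bar>x\<bar> \<le> real n" using m by (auto simp: n_def)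
    have "Cauchy (\<lambda>k. nth_deriv j (F k) x)"
    proof (rule CauchyI)
      fix e :: real assume "0 < e"
      then have "0 < e/2" by simp
      from C[OF this, of n] obtain N where
        N: "\<forall>k\<ge>N. \<forall>l\<ge>N. \<forall>j\<le>n. \<forall>x. \<bar>x\<bar> \<le> real n \<longrightarrow> norm (nth_deriv j (F k) x - nth_deriv j (F l) x) \<le> e/2"
        by blast
      have "norm (nth_deriv j (F k) x - nth_deriv j (F l) x) < e" if "k \<ge> N" "l \<ge> N" for k l
      proof -
        have "norm (nth_deriv j (F k) x - nth_deriv j (F l) x) \<le> e/2"
          using N that n by blast
        with \<open>0 < e\<close> show ?thesis by simp
      qed
      then show "\<exists>M. \<forall>k\<ge>M. \<forall>l\<ge>M. norm (nth_deriv j (F k) x - nth_deriv j (F l) x) < e"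
        by blast
    qed
    then show ?thesis unfolding G_def using Cauchy_convergent convergent_LIMSEQ_iff by blast
  qed
  have unif: "\<exists>N. \<forall>k\<ge>N. \<forall>j\<le>n. \<forall>x. \<bar>x\<bar> \<le> real n \<longrightarrow> norm (nth_deriv j (F k) x - G j x) \<le> e" if e: "0 < e" for n e
  proof -
    obtain N where N: "\<forall>k\<ge>N. \<forall>l\<ge>N. \<forall>j\<le>n. \<forall>x. \<bar>x\<bar> \<le> real n \<longrightarrow> norm (nth_deriv j (F k) x - nth_deriv j (F l) x) \<le> e"
      using C[OF e] by blast
    have "norm (nth_deriv j (F k) x - G j x) \<le> e" if "k \<ge> N" "j \<le> n" "\<bar>x\<bar> \<le> real n" for k j x
    proof (rule Lim_norm_ubound)
      show "(\<lambda>l. nth_deriv j (F k) x - nth_deriv j (F l) x) \<longlonglongrightarrow> nth_deriv j (F k) x - G j x"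
        by (intro tendsto_intros conv)
      show "\<forall>\<^sub>F l in sequentially. norm (nth_deriv j (F k) x - nth_deriv j (F l) x) \<le> e"
        using N that unfolding eventually_sequentially by (intro exI[of _ N]) blast
    qed simp
    then show ?thesis by blast
  qed
  have der: "(G j has_vector_derivative G (Suc j) x) (at x)" for j x
  proof -
    obtain m :: nat where m: "\<bar>x\<bar> < real m" using reals_Archimedean2 by blast
    define n where "n = max m (Suc j)"
    have n: "Suc j \<le> n" "\<bar>x\<bar> < real n" using m by (auto simp: n_def)
    define S where "S = {- real n<..<real n}"
    have S: "open S" "x \<in> S" using n by (auto simp: S_def)
    have "\<exists>g. \<forall>y\<in>S. (\<lambda>k. nth_deriv j (F k) y) \<longlonglongrightarrow> g y \<and>
        (g has_derivative (\<lambda>h. h *\<^sub>R G (Suc j) y)) (at y within S)"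
    proof (rule has_derivative_sequence)
      show "convex S" by (simp add: S_def)
      show "(nth_deriv j (F k) has_derivative (\<lambda>h. h *\<^sub>R nth_deriv (Suc j) (F k) y)) (at y within S)" for k y
        using smooth_has_vector_derivative[OF F, of j k y]
        by (simp add: has_vector_derivative_def has_derivative_at_withinI)
      show "\<forall>\<^sub>F k in sequentially. \<forall>y\<in>S. \<forall>h. norm (h *\<^sub>R nth_deriv (Suc j) (F k) y - h *\<^sub>R G (Suc j) y) \<le> e * norm h"
        if e: "0 < e" for e
      proof -
        obtain N where "\<forall>k\<ge>N. \<forall>j\<le>n. \<forall>x. \<bar>x\<bar> \<le> real n \<longrightarrow> norm (nth_deriv j (F k) x - G j x) \<le> e"
          using unif[OF e] by blast
        then have "norm (nth_deriv (Suc j) (F k) y - G (Suc j) y) \<le> e" if "k \<ge> N" "y \<in> S" for k y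
          using that n by (simp add: S_def abs_le_iff)
        then have "norm (h *\<^sub>R nth_deriv (Suc j) (F k) y - h *\<^sub>R G (Suc j) y) \<le> e * norm h"
          if "k \<ge> N" "y \<in> S" for k y h
          using that mult_left_mono[of _ e "norm h"]
          by (simp add: mult.commute[of e] flip: scaleR_diff_right)
        then show ?thesis by (auto simp: eventually_sequentially)
      qed
      show "x \<in> S" by fact
      show "(\<lambda>k. nth_deriv j (F k) x) \<longlonglongrightarrow> G j x" by (rule conv)
    qed
    then obtain g where g: "\<And>y. y \<in> S \<Longrightarrow> (\<lambda>k. nth_deriv j (F k) y) \<longlonglongrightarrow> g y"
      "\<And>y. y \<in> S \<Longrightarrow> (g has_vector_derivative G (Suc j) y) (at y within S)"
      unfolding has_vector_derivative_def by blast
    have eq: "G j y = g y" if y: "y \<in> S" for y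
      by (rule LIMSEQ_unique[OF conv g(1)[OF y]])
    have "(G j has_vector_derivative G (Suc j) x) (at x within S)"
      by (rule has_vector_derivative_transform[OF S(2) eq g(2)[OF S(2)]])
    then show ?thesis unfolding at_within_open[OF S(2,1)] .
  qed
  have nth: "nth_deriv j (G 0) = G j" for j
    by (induction j) (simp_all add: nth_deriv_Suc' vector_derivative_ext[OF der])
  show ?thesis
  proof
    show G0: "G 0 \<in> smooth_funs" unfolding smooth_funs_def
      using der by (auto simp: nth intro: differentiableI_vector)
    show "\<exists>N. \<forall>k\<ge>N. F k \<in> smooth_nbhd n e (G 0)" if "0 < e" for n e
      using unif[OF that, of n] by (simp add: smooth_nbhd_def deriv_bound_def F G0 nth_deriv_diff nth)
  qed
qed

lemma completely_metrizable_smooth_topology: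
  "completely_metrizable_space (smooth_topology :: (real \<Rightarrow> 'f::banach) topology)"
proof -
  interpret Metric_space "smooth_funs :: (real \<Rightarrow> 'f) set" smooth_dist by (rule Metric_space_smooth)
  have "mcomplete"
    unfolding mcomplete_def
  proof (intro allI impI)
    fix F :: "nat \<Rightarrow> real \<Rightarrow> 'f" assume F: "MCauchy F"
    have 1: "F k \<in> smooth_funs" for k using F by (auto simp: MCauchy_def)
    have 2: "\<exists>N. \<forall>k\<ge>N. \<forall>l\<ge>N. deriv_bound n (real n) (\<lambda>x. F k x - F l x) e" if "0 < e" for n e
    proof -
      have "0 < min e (1 / real (Suc n))" using that by simp
      with F obtain N where "\<forall>k\<ge>N. \<forall>l\<ge>N. smooth_dist (F l) (F k) < min e (1 / real (Suc n))"
        unfolding MCauchy_def by meson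
      then have "\<forall>k\<ge>N. \<forall>l\<ge>N. F k \<in> smooth_nbhd n e (F l)"
        using smooth_dist_ball_subset_nbhd[OF 1 1] by blast
      then show ?thesis by (auto simp: smooth_nbhd_def)
    qed
    obtain f where f: "f \<in> smooth_funs" "\<And>n e. 0 < e \<Longrightarrow> \<exists>N. \<forall>k\<ge>N. F k \<in> smooth_nbhd n e f"
      using smooth_funs_limit[OF 1 2] by blast
    have "limitin mtopology F f sequentially"
      unfolding smooth_topology_eq_mtopology limitin_def topspace_smooth_topology
    proof (intro conjI f allI impI)
      fix U assume "openin smooth_topology U \<and> f \<in> U"
      then obtain n e where "0 < e" "smooth_nbhd n e f \<subseteq> U" unfolding openin_smooth_topology by blast
      then show "\<forall>\<^sub>F k in sequentially. F k \<in> U"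
        using f(2)[of e n] by (auto simp: eventually_sequentially)
    qed
    then show "\<exists>f. limitin mtopology F f sequentially" by blast
  qed
  then show ?thesis
    unfolding completely_metrizable_space_def smooth_topology_eq_mtopology[symmetric]
    using Metric_space_smooth by blast
qed

section \<open>Continuity of the algebra operations\<close>

lemma openin_smooth_topologyE:
  assumes "openin smooth_topology U" "f \<in> U"
  obtains n e where "f \<in> smooth_funs" "0 < e" "smooth_nbhd n e f \<subseteq> U"
  using assms unfolding openin_smooth_topology by blast

text \<open>
  A criterion by neighbourhoods for continuity of an operation in two arguments; it serves for
  addition and multiplication.
\<close>

lemma continuous_map_smooth_binary:
  fixes op :: "(real \<Rightarrow> 'f::real_normed_vector) \<Rightarrow> (real \<Rightarrow> 'f) \<Rightarrow> (real \<Rightarrow> 'f)"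
  assumes cl: "\<And>f g. f \<in> smooth_funs \<Longrightarrow> g \<in> smooth_funs \<Longrightarrow> op f g \<in> smooth_funs"
    and ct: "\<And>f g n e. f \<in> smooth_funs \<Longrightarrow> g \<in> smooth_funs \<Longrightarrow> 0 < e \<Longrightarrow>
      \<exists>d>0. \<forall>f'\<in>smooth_nbhd n d f. \<forall>g'\<in>smooth_nbhd n d g. op f' g' \<in> smooth_nbhd n e (op f g)"
  shows "continuous_map (prod_topology smooth_topology smooth_topology) smooth_topology (\<lambda>(f, g). op f g)"
  unfolding continuous_map_def
proof (intro conjI allI impI)
  show "(\<lambda>(f, g). op f g) \<in> topspace (prod_topology smooth_topology smooth_topology) \<rightarrow> topspace smooth_topology"
    using cl by (auto simp: topspace_smooth_topology)
  fix U :: "(real \<Rightarrow> 'f) set" assume U: "openin smooth_topology U"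
  show "openin (prod_topology smooth_topology smooth_topology)
          {x \<in> topspace (prod_topology smooth_topology smooth_topology). (case x of (f, g) \<Rightarrow> op f g) \<in> U}"
    unfolding openin_prod_topology_alt
  proof (intro allI impI)
    fix f g assume "(f, g) \<in> {x \<in> topspace (prod_topology smooth_topology smooth_topology). (case x of (f, g) \<Rightarrow> op f g) \<in> U}"
    then have fg: "f \<in> smooth_funs" "g \<in> smooth_funs" "op f g \<in> U" by (auto simp: topspace_smooth_topology)
    obtain n e where e: "0 < e" "smooth_nbhd n e (op f g) \<subseteq> U"
      by (rule openin_smooth_topologyE[OF U fg(3)])
    obtain d where d: "0 < d" "\<forall>f'\<in>smooth_nbhd n d f. \<forall>g'\<in>smooth_nbhd n d g. op f' g' \<in> smooth_nbhd n e (op f g)"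
      using ct[OF fg(1,2) e(1)] by blast
    obtain A where A: "openin smooth_topology A" "f \<in> A" "A \<subseteq> smooth_nbhd n d f" using smooth_nbhd_open[OF fg(1) d(1)] by blast
    obtain B where B: "openin smooth_topology B" "g \<in> B" "B \<subseteq> smooth_nbhd n d g" using smooth_nbhd_open[OF fg(2) d(1)] by blast
    have "op f' g' \<in> U" if "f' \<in> A" "g' \<in> B" for f' g'
      using that A(3) B(3) d(2) e(2) by blast
    then have "A \<times> B \<subseteq> {x \<in> topspace (prod_topology smooth_topology smooth_topology). (case x of (f, g) \<Rightarrow> op f g) \<in> U}"
      using openin_subset[OF A(1)] openin_subset[OF B(1)] by auto
    with A B show "\<exists>A B. openin smooth_topology A \<and> openin smooth_topology B \<and> f \<in> A \<and> g \<in> B \<and>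
      A \<times> B \<subseteq> {x \<in> topspace (prod_topology smooth_topology smooth_topology). (case x of (f, g) \<Rightarrow> op f g) \<in> U}"
      by (intro exI[of _ A] exI[of _ B]) simp
  qed
qed

lemma continuous_map_smooth_add:
  "continuous_map (prod_topology smooth_topology smooth_topology) smooth_topology
     (\<lambda>(f, g). \<lambda>x. f x + g x :: 'f::real_normed_vector)"
proof (rule continuous_map_smooth_binary)
  fix f g :: "real \<Rightarrow> 'f" and n :: nat and e :: real
  assume fg: "f \<in> smooth_funs" "g \<in> smooth_funs" "0 < e"
  have "(\<lambda>x. f' x + g' x) \<in> smooth_nbhd n e (\<lambda>x. f x + g x)"
    if h: "f' \<in> smooth_nbhd n (e/2) f" "g' \<in> smooth_nbhd n (e/2) g" for f' g'
  proof -
    have s: "f' \<in> smooth_funs" "g' \<in> smooth_funs"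
      and b: "deriv_bound n n (\<lambda>x. f' x - f x) (e/2)" "deriv_bound n n (\<lambda>x. g' x - g x) (e/2)"
      using h by (auto simp: smooth_nbhd_def)
    have "deriv_bound n n (\<lambda>x. (f' x - f x) + (g' x - g x)) (e/2 + e/2)"
      by (intro deriv_bound_add smooth_diff fg s b)
    then show ?thesis by (simp add: smooth_nbhd_def smooth_add s algebra_simps)
  qed
  then show "\<exists>d>0. \<forall>f'\<in>smooth_nbhd n d f. \<forall>g'\<in>smooth_nbhd n d g.
      (\<lambda>x. f' x + g' x) \<in> smooth_nbhd n e (\<lambda>x. f x + g x)"
    using fg(3) by (intro exI[of _ "e/2"] conjI ballI) (simp, assumption)
qed (rule smooth_add)

text \<open>
  The estimate expands \<open>f' g' - f g = (f' - f) (g' - g) + f (g' - g) + (f' - f) g\<close>.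
\<close>

lemma continuous_map_smooth_mult:
  "continuous_map (prod_topology smooth_topology smooth_topology) smooth_topology
     (\<lambda>(f, g). \<lambda>x. f x * g x :: 'f::real_normed_algebra)"
proof (rule continuous_map_smooth_binary)
  fix f g :: "real \<Rightarrow> 'f" and n :: nat and e :: real
  assume fg: "f \<in> smooth_funs" "g \<in> smooth_funs" "0 < e"
  obtain a where a: "0 \<le> a" "deriv_bound n n f a" by (rule deriv_bound_exists[OF fg(1)])
  obtain b where b: "0 \<le> b" "deriv_bound n n g b" by (rule deriv_bound_exists[OF fg(2)])
  \<comment> \<open>for \<open>d \<le> 1\<close> the quadratic term \<open>2 ^ n * d * d\<close> is at most \<open>2 ^ n * d\<close>\<close>
  define d where "d = min 1 (e / (2 ^ n * (1 + a + b)))"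
  have pos: "0 < 2 ^ n * (1 + a + b)" using a b by (intro mult_pos_pos) auto
  then have d: "0 < d" "d \<le> 1" using fg by (auto simp: d_def)
  have "d \<le> e / (2 ^ n * (1 + a + b))" by (simp add: d_def)
  then have de: "2 ^ n * (1 + a + b) * d \<le> e" using pos by (simp add: field_simps)
  have "(\<lambda>x. f' x * g' x) \<in> smooth_nbhd n e (\<lambda>x. f x * g x)"
    if h: "f' \<in> smooth_nbhd n d f" "g' \<in> smooth_nbhd n d g" for f' g'
  proof -
    have s: "f' \<in> smooth_funs" "g' \<in> smooth_funs"
      and c: "deriv_bound n n (\<lambda>x. f' x - f x) d" "deriv_bound n n (\<lambda>x. g' x - g x) d"
      using h by (auto simp: smooth_nbhd_def)
    have bound: "deriv_bound n n (\<lambda>x. ((f' x - f x) * (g' x - g x) + f x * (g' x - g x)) + (f' x - f x) * g x)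
       ((2 ^ n * d * d + 2 ^ n * a * d) + 2 ^ n * d * b)"
      using d by (intro deriv_bound_add deriv_bound_mult smooth_add smooth_mult smooth_diff fg s c a b) auto
    have eq: "(\<lambda>x. ((f' x - f x) * (g' x - g x) + f x * (g' x - g x)) + (f' x - f x) * g x) =
      (\<lambda>x. f' x * g' x - f x * g x)" by (simp add: algebra_simps)
    have le: "(2 ^ n * d * d + 2 ^ n * a * d) + 2 ^ n * d * b \<le> e"
    proof -
      have "2 ^ n * d * d \<le> 2 ^ n * d" using d by (simp add: mult_left_le)
      then show ?thesis using de by (simp add: algebra_simps)
    qed
    have "deriv_bound n n (\<lambda>x. f' x * g' x - f x * g x) e"
      by (rule deriv_bound_mono[OF bound[unfolded eq] order_refl order_refl le])
    then show ?thesis by (simp add: smooth_nbhd_def smooth_mult s)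
  qed
  then show "\<exists>d>0. \<forall>f'\<in>smooth_nbhd n d f. \<forall>g'\<in>smooth_nbhd n d g.
      (\<lambda>x. f' x * g' x) \<in> smooth_nbhd n e (\<lambda>x. f x * g x)"
    using d by (intro exI[of _ d] conjI ballI) (assumption, assumption)
qed (rule smooth_mult)

section \<open>Density of polynomials\<close>

definition poly_fun :: "complex poly \<Rightarrow> real \<Rightarrow> complex" where
  "poly_fun p x = poly p (of_real x)"

lemma poly_fun_has_vector_derivative:
  "(poly_fun p has_vector_derivative poly_fun (pderiv p) x) (at x)"
  unfolding poly_fun_def
  by (intro has_vector_derivative_real_field poly_DERIV)

lemma smooth_poly_fun: "poly_fun p \<in> smooth_funs"
  using smooth_poly[OF smooth_of_real, of p] by (simp add: poly_fun_def[abs_def])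

lemma exists_antiderivative_poly:
  fixes q :: "'a::field_char_0 poly"
  shows "\<exists>p. pderiv p = q"
proof -
  define P where "P = (\<Sum>i\<le>degree q. monom (coeff q i / of_nat (Suc i)) (Suc i))"
  have "pderiv P = (\<Sum>i\<le>degree q. pderiv (monom (coeff q i / of_nat (Suc i)) (Suc i)))"
    unfolding P_def using sum_comp_morphism[of "pderiv :: 'a poly \<Rightarrow> _" "\<lambda>i. monom (coeff q i / of_nat (Suc i)) (Suc i)" "{..degree q}"]
    by (simp add: pderiv_add o_def del: of_nat_Suc)
  also have "\<dots> = (\<Sum>i\<le>degree q. monom (coeff q i) i)"
    by (intro sum.cong refl) (simp add: pderiv_monom del: of_nat_Suc)
  also have "\<dots> = q" by (rule poly_as_sum_of_monoms)
  finally show ?thesis by blast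
qed

text \<open>
  The Weierstrass theorem, applied to real and imaginary part.
\<close>

lemma poly_fun_approx_continuous:
  assumes "continuous_on {-r..r} f" "0 < e"
  obtains p where "\<And>x. \<bar>x\<bar> \<le> r \<Longrightarrow> norm (f x - poly_fun p x) \<le> e"
proof -
  have real: "\<exists>p. \<forall>x. \<bar>x\<bar> \<le> r \<longrightarrow> norm (of_real (g x) - poly_fun p x) \<le> e/2"
    if g: "continuous_on {-r..r} g" for g :: "real \<Rightarrow> real"
  proof -
    obtain h where h: "real_polynomial_function h" "\<And>x. x \<in> {-r..r} \<Longrightarrow> \<bar>g x - h x\<bar> < e/2"
      using Stone_Weierstrass_real_polynomial_function[OF compact_Icc g, of "e/2"] \<open>0 < e\<close> by (metis half_gt_zero)
    then obtain a n where ha: "h = (\<lambda>x. \<Sum>i\<le>n. a i * x ^ i)" using real_polynomial_function_iff_sum by blast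
    define p where "p = (\<Sum>i\<le>n. monom (complex_of_real (a i)) i)"
    have "poly_fun p x = of_real (h x)" for x
      by (simp add: p_def poly_fun_def poly_sum poly_monom ha)
    then have "norm (of_real (g x) - poly_fun p x) = \<bar>g x - h x\<bar>" for x
      by (metis norm_of_real of_real_diff real_norm_def)
    then show ?thesis using h(2) by (intro exI[of _ p]) (simp add: abs_le_iff less_imp_le)
  qed
  have "continuous_on {-r..r} (\<lambda>x. Re (f x))" "continuous_on {-r..r} (\<lambda>x. Im (f x))"
    by (intro continuous_intros assms)+
  from real[OF this(1)] real[OF this(2)] obtain p q where
    p: "\<And>x. \<bar>x\<bar> \<le> r \<Longrightarrow> norm (of_real (Re (f x)) - poly_fun p x) \<le> e/2" and
    q: "\<And>x. \<bar>x\<bar> \<le> r \<Longrightarrow> norm (of_real (Im (f x)) - poly_fun q x) \<le> e/2" by blast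
  show ?thesis
  proof
    fix x assume x: "\<bar>x\<bar> \<le> r"
    have "f x - poly_fun (p + smult \<i> q) x =
      (of_real (Re (f x)) - poly_fun p x) + \<i> * (of_real (Im (f x)) - poly_fun q x)"
      by (subst complex_eq[of "f x"]) (simp add: poly_fun_def algebra_simps)
    also have "norm \<dots> \<le> e/2 + norm (\<i> * (of_real (Im (f x)) - poly_fun q x))"
      by (intro order_trans[OF norm_triangle_ineq] add_right_mono p x)
    also have "\<dots> \<le> e/2 + e/2" using q[OF x] by (simp add: norm_mult)
    finally show "norm (f x - poly_fun (p + smult \<i> q) x) \<le> e" by simp
  qed
qed

text \<open>
  To approximate \<open>f\<close> together with its derivatives, approximate \<open>f'\<close> by a polynomial and integrate it
  from \<open>0\<close> with the initial value \<open>f 0\<close>. On an interval of radius \<open>r\<close> the integration multiplies the error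
  by at most \<open>r\<close>.
\<close>

lemma poly_fun_approx:
  assumes "f \<in> smooth_funs" "0 < e" "0 \<le> r"
  shows "\<exists>p. deriv_bound j r (\<lambda>x. f x - poly_fun p x) e"
  using assms
proof (induction j arbitrary: f e)
  case 0
  have "continuous_on {-r..r} f" using smooth_continuous[OF 0(1), of _ 0] by simp
  then obtain p where "\<And>x. \<bar>x\<bar> \<le> r \<Longrightarrow> norm (f x - poly_fun p x) \<le> e"
    using poly_fun_approx_continuous 0(2) by metis
  then show ?case by (auto simp: deriv_bound_def)
next
  case (Suc j)
  let ?f' = "nth_deriv 1 f"
  have f': "(f has_vector_derivative ?f' x) (at x)" for x
    using smooth_has_vector_derivative[OF Suc.prems(1), of 0] by simp
  obtain q where q: "deriv_bound j r (\<lambda>x. ?f' x - poly_fun q x) (e / (1 + r))"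
    using Suc.IH[OF smooth_nth_deriv[OF Suc.prems(1), of 1], of "e / (1 + r)"] Suc.prems by auto
  obtain p0 where p0: "pderiv p0 = q" using exists_antiderivative_poly by blast
  \<comment> \<open>the antiderivative with the value \<open>f 0\<close> at \<open>0\<close>\<close>
  define p where "p = p0 + [:f 0 - poly p0 0:]"
  have p: "pderiv p = q" "poly_fun p 0 = f 0" by (auto simp: p_def pderiv_add p0 poly_fun_def pderiv_pCons)
  let ?h = "\<lambda>x. f x - poly_fun p x"
  have h: "(?h has_vector_derivative (?f' x - poly_fun q x)) (at x)" for x
    using poly_fun_has_vector_derivative[of p x] by (intro has_vector_derivative_diff f') (simp add: p)
  have "norm (?h x) \<le> e" if x: "\<bar>x\<bar> \<le> r" for x
  proof -
    have "norm (?h x - ?h 0) \<le> e / (1 + r) * norm (x - 0)"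
    proof (rule differentiable_bound)
      show "(?h has_derivative (\<lambda>t. t *\<^sub>R (?f' y - poly_fun q y))) (at y within {-r..r})" for y
        using has_vector_derivative_at_within[OF h] by (simp only: has_vector_derivative_def)
      show "onorm (\<lambda>t. t *\<^sub>R (?f' y - poly_fun q y)) \<le> e / (1 + r)" if y: "y \<in> {-r..r}" for y
      proof -
        have "\<bar>y\<bar> \<le> r" using y by (auto simp: abs_le_iff)
        then have "norm (?f' y - poly_fun q y) \<le> e / (1 + r)"
          using q unfolding deriv_bound_def by force
        from mult_left_mono[OF this abs_ge_zero] show ?thesis
          using Suc.prems by (intro onorm_bound) (simp_all add: mult.commute)
      qed
    qed (use x \<open>0 \<le> r\<close> in \<open>auto simp: abs_le_iff\<close>)
    also have "\<dots> \<le> e / (1 + r) * (1 + r)" using x Suc.prems by (intro mult_left_mono) auto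
    also have "\<dots> = e" using Suc.prems by simp
    finally show ?thesis by (simp add: p)
  qed
  moreover have "deriv_bound j r (\<lambda>x. ?f' x - poly_fun q x) e"
    using Suc.prems by (intro deriv_bound_mono[OF q]) (auto simp: field_simps)
  ultimately show ?case
    by (intro exI[of _ p]) (simp add: deriv_bound_Suc vector_derivative_ext[OF h])
qed

lemma poly_fun_dense:
  assumes "openin smooth_topology U" "U \<noteq> {}"
  shows "\<exists>p. poly_fun p \<in> U"
proof -
  obtain f where "f \<in> U" using assms by blast
  then obtain n e where f: "f \<in> smooth_funs" "0 < e" "smooth_nbhd n e f \<subseteq> U"
    using assms unfolding openin_smooth_topology by blast
  then obtain p where "deriv_bound n n (\<lambda>x. f x - poly_fun p x) e"
    using poly_fun_approx[OF f(1,2)] by force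
  then have "deriv_bound n n (\<lambda>x. poly_fun p x - f x) e"
    using deriv_bound_minus[OF smooth_diff[OF f(1) smooth_poly_fun]] by simp
  then have "poly_fun p \<in> smooth_nbhd n e f" by (simp add: smooth_nbhd_def smooth_poly_fun)
  then show ?thesis using f by blast
qed

text \<open>
  Polynomials with coefficients in a countable dense set of complex numbers. The coefficients are
  adjusted one after the other, following the Horner scheme.
\<close>

lemma separable_smooth_topology:
  obtains D :: "(real \<Rightarrow> complex) set" where "countable D" "smooth_topology closure_of D = topspace smooth_topology"
proof -
  obtain C :: "complex set" where C: "countable C" "\<And>X. open X \<Longrightarrow> X \<noteq> {} \<Longrightarrow> \<exists>d\<in>C. d \<in> X"
    using countable_dense_exists by blast
  let ?D = "(\<lambda>l. poly_fun (Poly l)) ` lists C"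
  have approx: "\<exists>l\<in>lists C. poly_fun (Poly l) \<in> smooth_nbhd n e (poly_fun p)" if "0 < e" for n e p
    using that
  proof (induction p arbitrary: e)
    case 0
    show ?case using 0 by (intro bexI[of _ "[]"]) (auto simp: smooth_nbhd_self smooth_poly_fun)
  next
    case (pCons c p)
    obtain b where b: "0 \<le> b" "deriv_bound n n complex_of_real b"
      by (rule deriv_bound_exists[OF smooth_of_real])
    define d where "d = e / (2 * (2 ^ n * (b + 1)))"
    have pos: "0 < 2 ^ n * (b + 1)" using b by (intro mult_pos_pos) auto
    have d: "0 < d" using pos pCons.prems by (simp add: d_def)
    from pCons.IH[OF d] obtain l where l: "l \<in> lists C" "poly_fun (Poly l) \<in> smooth_nbhd n d (poly_fun p)" by blast
    obtain c' where c': "c' \<in> C" "c' \<in> ball c (e/2)" using C(2)[of "ball c (e/2)"] pCons.prems by auto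
    have bound: "deriv_bound n n (\<lambda>x. (c' - c) + of_real x * (poly_fun (Poly l) x - poly_fun p x)) (e/2 + 2 ^ n * b * d)"
    proof (intro deriv_bound_add deriv_bound_mult smooth_mult smooth_diff smooth_poly_fun smooth_of_real b)
      show "deriv_bound n n (\<lambda>x. c' - c) (e/2)"
        using c' pCons.prems by (auto simp: deriv_bound_def nth_deriv_const dist_norm norm_minus_commute)
      show "deriv_bound n n (\<lambda>x. poly_fun (Poly l) x - poly_fun p x) d" using l by (simp add: smooth_nbhd_def)
    qed (use d in auto)
    have le: "e/2 + 2 ^ n * b * d \<le> e"
    proof -
      have half: "K * (e / (2 * K)) = e/2" if "0 < K" for K :: real using that by simp
      have "2 ^ n * b * d \<le> 2 ^ n * (b + 1) * d" using d by simp
      also have "\<dots> = e/2" unfolding d_def by (rule half[OF pos])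
      finally show ?thesis by simp
    qed
    note bound = deriv_bound_mono[OF bound order_refl order_refl le]
    then have "poly_fun (Poly (c' # l)) \<in> smooth_nbhd n e (poly_fun (pCons c p))"
      by (simp add: smooth_nbhd_def smooth_poly_fun) (simp add: poly_fun_def algebra_simps)
    then show ?case using l c' by (intro bexI[of _ "c' # l"]) auto
  qed
  show ?thesis
  proof
    show "countable ?D" using C(1) by auto
    show "smooth_topology closure_of ?D = topspace smooth_topology"
      unfolding dense_intersects_open
    proof (intro allI impI)
      fix U :: "(real \<Rightarrow> complex) set" assume U: "openin smooth_topology U \<and> U \<noteq> {}"
      then obtain p where "poly_fun p \<in> U" using poly_fun_dense by blast
      then obtain n e where "0 < e" "smooth_nbhd n e (poly_fun p) \<subseteq> U"
        using U unfolding openin_smooth_topology by blast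
      then show "?D \<inter> U \<noteq> {}" using approx[of e n p] by blast
    qed
  qed
qed

section \<open>Translations are mixing\<close>

definition gauss :: "real \<Rightarrow> complex" where "gauss x = exp (- (of_real x)\<^sup>2)"

text \<open>
  The products of polynomials with a Gaussian are closed under differentiation, so smoothness and
  decay of all their derivatives reduce to the functions themselves.
\<close>

lemma poly_gauss_has_vector_derivative:
  "((\<lambda>x. poly_fun p x * gauss x) has_vector_derivative poly_fun (pderiv p - [:0, 2:] * p) x * gauss x) (at x)"
  unfolding poly_fun_def gauss_def
  by (rule has_vector_derivative_real_field) (auto intro!: derivative_eq_intros simp: algebra_simps)

lemma times_differentiable_poly_gauss: "times_differentiable k (\<lambda>x. poly_fun p x * gauss x)"
proof (induction k arbitrary: p)
  case (Suc k)
  show ?case by (rule times_differentiable_SucI[OF poly_gauss_has_vector_derivative Suc])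
qed auto

lemma smooth_poly_gauss: "(\<lambda>x. poly_fun p x * gauss x) \<in> smooth_funs"
  by (simp add: smooth_funs_iff times_differentiable_poly_gauss)

lemma gauss_nonzero: "gauss x \<noteq> 0" by (simp add: gauss_def)

lemma smooth_gauss: "gauss \<in> smooth_funs"
  using smooth_poly_gauss[of 1] by (simp add: poly_fun_def)

lemma smooth_inverse: "f \<in> smooth_funs \<Longrightarrow> (\<And>x. f x \<noteq> 0) \<Longrightarrow> (\<lambda>x. inverse (f x)) \<in> smooth_funs"
  for f :: "real \<Rightarrow> 'f::real_normed_field"
  by (simp add: smooth_funs_iff times_differentiable_inverse)

lemma nth_deriv_poly_gauss:
  "\<exists>q. nth_deriv j (\<lambda>x. poly_fun p x * gauss x) = (\<lambda>x. poly_fun q x * gauss x)"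
proof (induction j arbitrary: p)
  case (Suc j)
  then show ?case by (simp add: nth_deriv_Suc vector_derivative_ext[OF poly_gauss_has_vector_derivative])
qed auto

lemma poly_gauss_vanishes:
  assumes "0 < e"
  obtains R where "\<And>x. \<bar>x\<bar> \<ge> R \<Longrightarrow> norm (poly_fun p x * gauss x) \<le> e"
proof -
  have "((\<lambda>t. \<Sum>i\<le>degree p. norm (coeff p i) * (t ^ i / exp t)) \<longlongrightarrow> (\<Sum>i\<le>degree p. norm (coeff p i) * 0)) at_top"
    by (intro tendsto_intros tendsto_power_div_exp_0)
  then have "\<forall>\<^sub>F t in at_top. (\<Sum>i\<le>degree p. norm (coeff p i) * (t ^ i / exp t)) < e"
    using assms by (intro order_tendstoD(2)[where y = 0]) auto
  then obtain R where R: "\<And>t. t \<ge> R \<Longrightarrow> (\<Sum>i\<le>degree p. norm (coeff p i) * (t ^ i / exp t)) < e"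
    unfolding eventually_at_top_linorder by blast
  show ?thesis
  proof
    fix x :: real assume x: "max 1 R \<le> \<bar>x\<bar>"
    have "norm (poly_fun p x) \<le> (\<Sum>i\<le>degree p. norm (coeff p i) * \<bar>x\<bar> ^ i)"
      unfolding poly_fun_def poly_altdef
      by (rule order_trans[OF norm_sum]) (simp add: norm_mult norm_power)
    moreover have "norm (gauss x) \<le> inverse (exp \<bar>x\<bar>)"
    proof -
      have "\<bar>x\<bar> * 1 \<le> \<bar>x\<bar> * \<bar>x\<bar>" using x by (intro mult_left_mono) auto
      then have "\<bar>x\<bar> \<le> x\<^sup>2" by (simp add: power2_eq_square)
      then show ?thesis by (simp add: gauss_def flip: exp_minus of_real_power)
    qed
    ultimately have "norm (poly_fun p x) * norm (gauss x) \<le> (\<Sum>i\<le>degree p. norm (coeff p i) * \<bar>x\<bar> ^ i) * inverse (exp \<bar>x\<bar>)"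
      by (intro mult_mono) (auto intro!: sum_nonneg)
    also have "\<dots> = (\<Sum>i\<le>degree p. norm (coeff p i) * (\<bar>x\<bar> ^ i / exp \<bar>x\<bar>))"
      by (simp add: sum_distrib_right divide_inverse mult.assoc)
    also have "\<dots> \<le> e" using R[of "\<bar>x\<bar>"] x by simp
    finally show "norm (poly_fun p x * gauss x) \<le> e" by (simp add: norm_mult)
  qed
qed

text \<open>
  The Gaussian has no zeros, so multiplication by it is a homeomorphism of the space and preserves
  density of the polynomials.
\<close>

lemma poly_gauss_dense:
  assumes "openin smooth_topology U" "U \<noteq> {}"
  shows "\<exists>p. (\<lambda>x. poly_fun p x * gauss x) \<in> U"
proof -
  obtain g where g: "g \<in> U" "g \<in> smooth_funs" using assms openin_smooth_topology by blast
  let ?V = "{f \<in> topspace smooth_topology. (\<lambda>x. f x * gauss x) \<in> U}"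
  have "continuous_map smooth_topology smooth_topology (\<lambda>f x. f x * gauss x)"
  proof -
    have "continuous_map smooth_topology (prod_topology smooth_topology smooth_topology) (\<lambda>f. (f, gauss))"
      by (simp add: continuous_map_pairedI topspace_smooth_topology smooth_gauss)
    from continuous_map_compose[OF this continuous_map_smooth_mult] show ?thesis by (simp add: o_def)
  qed
  then have "openin smooth_topology ?V" using assms(1) by (rule openin_continuous_map_preimage)
  moreover have "(\<lambda>x. g x * inverse (gauss x)) \<in> ?V"
    using g by (simp add: topspace_smooth_topology smooth_mult smooth_inverse smooth_gauss gauss_nonzero mult.assoc)
  ultimately obtain p where "poly_fun p \<in> ?V" using poly_fun_dense by blast
  then show ?thesis by blast
qed

lemma translates_vanish:
  assumes "0 < e" "a \<noteq> 0"
  obtains N where "\<And>n. n \<ge> N \<Longrightarrow> deriv_bound m r (translation (real n * a) (\<lambda>x. poly_fun p x * gauss x)) e"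
proof -
  let ?f = "\<lambda>x. poly_fun p x * gauss x"
  have "\<exists>R. \<forall>x. \<bar>x\<bar> \<ge> R \<longrightarrow> norm (nth_deriv i ?f x) \<le> e" for i
    using nth_deriv_poly_gauss[of i p] poly_gauss_vanishes[OF assms(1)] by metis
  then obtain R where R: "\<And>i x. \<bar>x\<bar> \<ge> R i \<Longrightarrow> norm (nth_deriv i ?f x) \<le> e" by metis
  obtain N :: nat where N: "Max (R ` {..m}) + r \<le> real N * \<bar>a\<bar>"
    using ex_less_of_nat_mult[of "\<bar>a\<bar>" "Max (R ` {..m}) + r"] assms(2) less_imp_le by auto
  show ?thesis
  proof
    fix n assume n: "n \<ge> N"
    show "deriv_bound m r (translation (real n * a) ?f) e"
      unfolding deriv_bound_def nth_deriv_translation[OF smooth_poly_gauss]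
    proof (intro allI impI)
      fix i x assume "i \<le> m" "\<bar>x\<bar> \<le> r"
      have "R i \<le> Max (R ` {..m})" using \<open>i \<le> m\<close> by auto
      moreover have "real N * \<bar>a\<bar> \<le> real n * \<bar>a\<bar>" using n by (intro mult_right_mono) auto
      moreover have "real n * \<bar>a\<bar> = \<bar>real n * a\<bar>" by (simp add: abs_mult)
      ultimately have "R i \<le> \<bar>x + real n * a\<bar>" using N \<open>\<bar>x\<bar> \<le> r\<close> by linarith
      then show "norm (translation (real n * a) (nth_deriv i ?f) x) \<le> e"
        using R by (simp add: translation_def)
    qed
  qed
qed

lemma translation_funpow: "(translation a ^^ n) f = translation (real n * a) f"
  by (induction n) (simp_all add: translation_def algebra_simps)

text \<open>
  Pick \<open>u \<in> U\<close> and \<open>v \<in> V\<close> among the products of polynomials with the Gaussian. The function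
  \<open>u + v(x - n a)\<close> is close to \<open>u\<close>, and its translate \<open>u(x + n a) + v\<close> is close to \<open>v\<close>, for large \<open>n\<close>.
\<close>

lemma translation_mixing:
  fixes U V :: "(real \<Rightarrow> complex) set"
  assumes "a \<noteq> 0" and U: "openin smooth_topology U" "U \<noteq> {}" and V: "openin smooth_topology V" "V \<noteq> {}"
  shows "\<exists>N. \<forall>n\<ge>N. \<exists>f\<in>U. (translation a ^^ n) f \<in> V"
proof -
  obtain p where p: "(\<lambda>x. poly_fun p x * gauss x) \<in> U" (is "?u \<in> U") using poly_gauss_dense[OF U] by blast
  obtain q where q: "(\<lambda>x. poly_fun q x * gauss x) \<in> V" (is "?v \<in> V") using poly_gauss_dense[OF V] by blast
  obtain k d where kd: "0 < d" "smooth_nbhd k d ?u \<subseteq> U" using U p unfolding openin_smooth_topology by blast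
  obtain l e where le: "0 < e" "smooth_nbhd l e ?v \<subseteq> V" using V q unfolding openin_smooth_topology by blast
  obtain M where M: "\<And>n. n \<ge> M \<Longrightarrow> deriv_bound k k (translation (real n * (- a)) ?v) d"
    using translates_vanish[OF kd(1), of "-a" k k q] \<open>a \<noteq> 0\<close> by auto
  obtain N where N: "\<And>n. n \<ge> N \<Longrightarrow> deriv_bound l l (translation (real n * a) ?u) e"
    using translates_vanish[OF le(1) \<open>a \<noteq> 0\<close>, of l l p] by auto
  have "\<exists>f\<in>U. (translation a ^^ n) f \<in> V" if n: "n \<ge> max M N" for n
  proof (intro bexI)
    let ?f = "\<lambda>x. ?u x + translation (real n * (- a)) ?v x"
    have "(translation a ^^ n) ?f = (\<lambda>x. translation (real n * a) ?u x + ?v x)"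
      by (simp add: translation_funpow) (simp add: translation_def)
    also have "\<dots> \<in> smooth_nbhd l e ?v"
      unfolding smooth_nbhd_def using N[of n] n
      by (simp add: smooth_add smooth_translation smooth_poly_gauss)
    finally show "(translation a ^^ n) ?f \<in> V" using le by blast
    have "?f \<in> smooth_nbhd k d ?u"
      unfolding smooth_nbhd_def using M[of n] n smooth_translation[OF smooth_poly_gauss]
      by (simp add: smooth_add smooth_poly_gauss)
    then show "?f \<in> U" using kd by blast
  qed
  then show ?thesis by blast
qed

section \<open>Algebras in which squares are not dense\<close>

lemma multiplicative_funpow_square:
  assumes "multiplicative_operator K X T" "f \<in> topspace X"
    and sq: "\<And>g. g \<in> topspace X \<Longrightarrow> (\<lambda>x. g x * g x) \<in> topspace X"
  shows "(T ^^ n) f \<in> topspace X" "(T ^^ n) (\<lambda>x. f x * f x) = (\<lambda>x. (T ^^ n) f x * (T ^^ n) f x)"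
proof -
  have T: "T g \<in> topspace X" if "g \<in> topspace X" for g
    using assms(1) that continuous_map_funspace unfolding multiplicative_operator_def operator_on_def by blast
  show top: "(T ^^ n) f \<in> topspace X" for n
    by (induction n) (auto intro: T assms)
  show "(T ^^ n) (\<lambda>x. f x * f x) = (\<lambda>x. (T ^^ n) f x * (T ^^ n) f x)"
  proof (induction n)
    case (Suc n)
    then show ?case using assms(1) top[of n] unfolding multiplicative_operator_def by simp
  qed simp
qed

text \<open>
  The square of a nonzero element is again a nonzero element of the algebra, because the values of
  functions lie in a field, and its orbit consists of squares.
\<close>

lemma no_hypercyclic_algebra_if_squares_not_dense:
  assumes T: "multiplicative_operator K X T"
    and sq: "\<And>g. g \<in> topspace X \<Longrightarrow> (\<lambda>x. g x * g x) \<in> topspace X"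
    and W: "openin X W" "W \<noteq> {}" "\<And>g. g \<in> topspace X \<Longrightarrow> (\<lambda>x. g x * g x) \<notin> W"
  shows "\<not> hypercyclic_algebra K X T A"
proof
  assume A: "hypercyclic_algebra K X T A"
  then obtain f where f: "f \<in> A" "f \<noteq> (\<lambda>x. 0)" "f \<in> topspace X"
    unfolding hypercyclic_algebra_def fun_subalgebra_def by blast
  let ?g = "\<lambda>x. f x * f x"
  have "?g \<in> A" using A f unfolding hypercyclic_algebra_def fun_subalgebra_def by blast
  moreover have "?g \<noteq> (\<lambda>x. 0)" using f(2) by (auto simp: fun_eq_iff)
  ultimately have "hypercyclic_vector X T ?g" using A unfolding hypercyclic_algebra_def by blast
  then have "range (\<lambda>n. (T ^^ n) ?g) \<inter> W \<noteq> {}"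
    using W(1,2) unfolding hypercyclic_vector_def dense_intersects_open by blast
  then obtain n where "(T ^^ n) ?g \<in> W" by blast
  then show False
    using W(3) multiplicative_funpow_square[OF T f(3) sq, of n] by metis
qed

lemma smooth_real_no_hypercyclic_algebra:
  assumes "multiplicative_operator (UNIV :: real set) smooth_topology T"
  shows "\<not> hypercyclic_algebra UNIV smooth_topology T A"
proof -
  obtain W :: "(real \<Rightarrow> real) set" where W: "openin smooth_topology W" "(\<lambda>x. -1) \<in> W" "W \<subseteq> smooth_nbhd 0 (1/2) (\<lambda>x. -1)"
    using smooth_nbhd_open[OF smooth_const[of "-1::real"], of "1/2" 0] by auto
  have "(\<lambda>x. g x * g x) \<notin> smooth_nbhd 0 (1/2) (\<lambda>x. -1)" for g :: "real \<Rightarrow> real"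
  proof
    assume "(\<lambda>x. g x * g x) \<in> smooth_nbhd 0 (1/2) (\<lambda>x. -1)"
    then have "\<bar>g 0 * g 0 - (-1)\<bar> \<le> 1/2" by (simp add: smooth_nbhd_def deriv_bound_def)
    then show False using zero_le_square[of "g 0"] by linarith
  qed
  with W show ?thesis
    by (intro no_hypercyclic_algebra_if_squares_not_dense[OF assms, of W])
      (auto simp: topspace_smooth_topology smooth_mult)
qed

lemma real_entire_no_hypercyclic_algebra:
  assumes "multiplicative_operator (\<real> :: complex set) real_entire_topology T"
  shows "\<not> hypercyclic_algebra \<real> real_entire_topology T A"
proof (rule no_hypercyclic_algebra_if_squares_not_dense[OF assms])
  fix g :: "complex \<Rightarrow> complex" assume "g \<in> topspace real_entire_topology"
  then show "(\<lambda>x. g x * g x) \<in> topspace real_entire_topology"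
    by (auto simp: topspace_real_entire_topology intro!: holomorphic_intros)
next
  let ?V = "{f \<in> hol_funs UNIV. f ` {0} \<subseteq> {z. Re z < 0}}"
  let ?W = "?V \<inter> {f. f ` \<real> \<subseteq> \<real>}"
  have "openin (hol_topology UNIV) ?V"
    unfolding hol_topology_def
    by (rule topology_generated_by_Basis) (intro CollectI exI[of _ "{0}"] exI[of _ "{z. Re z < 0}"], simp add: open_halfspace_Re_lt)
  then show "openin real_entire_topology ?W"
    unfolding real_entire_topology_def by (auto simp: openin_subtopology)
  have "(\<lambda>z. -1) \<in> ?W" by (auto simp: hol_funs_def)
  then show "?W \<noteq> {}" by blast
  fix g :: "complex \<Rightarrow> complex" assume "g \<in> topspace real_entire_topology"
  then have "g 0 \<in> \<real>" by (auto simp: topspace_real_entire_topology)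
  then show "(\<lambda>x. g x * g x) \<notin> ?W"
    by (auto simp: Reals_def mult_less_0_iff)
qed

text \<open>
  Compact-open neighbourhoods control functions uniformly on compact sets: cover \<open>C\<close> by finitely many
  small discs on which \<open>g\<close> is nearly constant, and prescribe the values on each piece.
\<close>

lemma hol_topology_uniform_nbhd:
  assumes g: "g \<in> hol_funs \<Omega>" and C: "compact C" "C \<subseteq> \<Omega>" and "0 < e"
  obtains W where "openin (hol_topology \<Omega>) W" "g \<in> W" "\<And>f z. f \<in> W \<Longrightarrow> z \<in> C \<Longrightarrow> norm (f z - g z) \<le> e"
proof -
  have cont: "continuous_on C g"
    using g C by (auto simp: hol_funs_def intro: holomorphic_on_imp_continuous_on continuous_on_subset)
  then have "uniformly_continuous_on C g" using C(1) compact_uniformly_continuous by blast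
  then obtain d where d: "0 < d" "\<And>x y. x \<in> C \<Longrightarrow> y \<in> C \<Longrightarrow> dist y x < d \<Longrightarrow> dist (g y) (g x) < e/2"
    unfolding uniformly_continuous_on_def using \<open>0 < e\<close> by (metis half_gt_zero)
  obtain K where K: "finite K" "K \<subseteq> C" "C \<subseteq> (\<Union>c\<in>K. ball c (d/2))"
    using compactE_image[OF C(1), of C "\<lambda>c. ball c (d/2)"] d(1) by (metis (no_types, lifting) UN_I centre_in_ball half_gt_zero open_ball subsetI)
  define P where "P c = {f \<in> hol_funs \<Omega>. f ` (C \<inter> cball c (d/2)) \<subseteq> ball (g c) (e/2)}" for c
  have P: "openin (hol_topology \<Omega>) (P c)" for c
    unfolding P_def hol_topology_def
    by (rule topology_generated_by_Basis) (use C in \<open>blast intro: compact_Int_closed closed_cball open_ball\<close>)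
  define W where "W = hol_funs \<Omega> \<inter> (\<Inter>c\<in>K. P c)"
  show ?thesis
  proof
    show "openin (hol_topology \<Omega>) W"
    proof (cases "K = {}")
      case True
      then show ?thesis unfolding W_def by (simp flip: topspace_hol_topology)
    next
      case False
      have "openin (hol_topology \<Omega>) (hol_funs \<Omega>)" by (simp flip: topspace_hol_topology)
      then show ?thesis unfolding W_def using P K(1) False by (intro openin_Int openin_INT2) auto
    qed
    show "g \<in> W"
      using g K(2) d by (auto simp: W_def P_def dist_commute subset_iff intro!: d(2))
    fix f z assume fz: "f \<in> W" "z \<in> C"
    then obtain c where c: "c \<in> K" "z \<in> ball c (d/2)" using K(3) by blast
    then have "z \<in> C \<inter> cball c (d/2)" using fz(2) by auto
    then have "f z \<in> ball (g c) (e/2)" using fz(1) c(1) unfolding W_def P_def by blast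
    moreover have "dist (g z) (g c) < e/2" using c K(2) fz d(1) by (intro d(2)) (auto simp: dist_commute)
    ultimately have "dist (f z) (g z) < e" by (metis dist_commute dist_triangle_half_l mem_ball)
    then show "norm (f z - g z) \<le> e" by (simp add: dist_norm)
  qed
qed

text \<open>
  If \<open>h\<^sup>2\<close> is close to \<open>z - a\<close>, it has a zero \<open>w\<close> near \<open>a\<close> by the fixed point theorem of Brouwer. There
  the derivative \<open>2 h h'\<close> of \<open>h\<^sup>2\<close> vanishes as well, whereas by the Cauchy estimate it is close to the
  derivative \<open>1\<close> of \<open>z - a\<close>.
\<close>

lemma square_not_near_simple_zero:
  fixes h :: "complex \<Rightarrow> complex"
  assumes h: "h holomorphic_on S" "open S" "cball a r \<subseteq> S" and "0 < r"
    and near: "\<And>z. z \<in> cball a r \<Longrightarrow> norm (h z * h z - (z - a)) \<le> r/3"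
  shows False
proof -
  let ?G = "\<lambda>z. h z * h z - (z - a)"
  have hol: "?G holomorphic_on S" by (intro holomorphic_intros h)
  obtain w where w: "w \<in> cball a (r/3)" "a - ?G w = w"
  proof -
    \<comment> \<open>a fixed point of \<open>z \<mapsto> a - ?G z = z - h z * h z\<close> is a zero of \<open>h\<close>\<close>
    have "\<exists>w\<in>cball a (r/3). (\<lambda>z. a - ?G z) w = w"
    proof (rule brouwer)
      show "continuous_on (cball a (r/3)) (\<lambda>z. a - ?G z)"
        using h \<open>0 < r\<close> by (intro continuous_intros continuous_on_subset[OF holomorphic_on_imp_continuous_on[OF h(1)]])
          (auto intro: order_trans[OF _ h(3)])
      show "(\<lambda>z. a - ?G z) \<in> cball a (r/3) \<rightarrow> cball a (r/3)"
      proof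
        fix z assume "z \<in> cball a (r/3)"
        then have "norm (?G z) \<le> r/3" using \<open>0 < r\<close> by (intro near) auto
        moreover have "a - (a - ?G z) = ?G z" by simp
        ultimately show "a - ?G z \<in> cball a (r/3)" unfolding mem_cball dist_norm by (simp only:)
      qed
    qed (use \<open>0 < r\<close> in auto)
    then show ?thesis using that by force
  qed
  then have "h w = 0" by simp
  have wS: "w \<in> S" using w h(3) \<open>0 < r\<close> by auto
  have sub: "cball w (2*r/3) \<subseteq> cball a r"
    using w by (intro subsetI) (auto simp: dist_commute intro: order_trans[OF dist_triangle[of _ _ w]])
  have "norm ((deriv ^^ 1) ?G w) \<le> fact 1 * (r/3) / (2*r/3) ^ 1"
  proof (rule Cauchy_inequality)
    show "?G holomorphic_on ball w (2*r/3)"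
      using sub h(3) ball_subset_cball by (intro holomorphic_on_subset[OF hol]) blast
    show "continuous_on (cball w (2*r/3)) ?G"
      using sub h(3) by (intro continuous_on_subset[OF holomorphic_on_imp_continuous_on[OF hol]]) blast
    show "norm (?G z) \<le> r/3" if "norm (w - z) = 2*r/3" for z
      using that sub by (intro near) (auto simp: dist_norm subset_iff)
  qed (use \<open>0 < r\<close> in auto)
  moreover have "deriv ?G w = -1"
  proof (rule DERIV_imp_deriv)
    have "(h has_field_derivative deriv h w) (at w)" using h wS holomorphic_derivI by blast
    then show "(?G has_field_derivative -1) (at w)"
      by (auto intro!: derivative_eq_intros simp: \<open>h w = 0\<close>)
  qed
  ultimately show False using \<open>0 < r\<close> by simp
qed

lemma hol_no_hypercyclic_algebra:
  assumes \<Omega>: "open \<Omega>" "\<Omega> \<noteq> {}" and T: "multiplicative_operator UNIV (hol_topology \<Omega>) T"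
  shows "\<not> hypercyclic_algebra UNIV (hol_topology \<Omega>) T A"
proof -
  obtain a where "a \<in> \<Omega>" using \<Omega> by blast
  then obtain r where r: "0 < r" "cball a r \<subseteq> \<Omega>" using \<Omega>(1) open_contains_cball by blast
  define g where "g z = (if z \<in> \<Omega> then z - a else 0)" for z
  have "g holomorphic_on \<Omega> \<longleftrightarrow> (\<lambda>z. z - a) holomorphic_on \<Omega>"
    by (rule holomorphic_cong) (auto simp: g_def)
  then have g: "g \<in> hol_funs \<Omega>" by (auto simp: hol_funs_def g_def[abs_def] intro!: holomorphic_intros)
  obtain W where W: "openin (hol_topology \<Omega>) W" "g \<in> W"
    "\<And>f z. f \<in> W \<Longrightarrow> z \<in> cball a r \<Longrightarrow> norm (f z - g z) \<le> r/3"
    by (rule hol_topology_uniform_nbhd[OF g compact_cball r(2), of "r/3"]) (use r in auto)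
  show ?thesis
  proof (rule no_hypercyclic_algebra_if_squares_not_dense[OF T])
    show "(\<lambda>x. h x * h x) \<in> topspace (hol_topology \<Omega>)" if "h \<in> topspace (hol_topology \<Omega>)" for h
      using that by (auto simp: topspace_hol_topology hol_funs_def intro!: holomorphic_intros)
    show "openin (hol_topology \<Omega>) W" by fact
    show "W \<noteq> {}" using W(2) by blast
    show "(\<lambda>x. h x * h x) \<notin> W" if h: "h \<in> topspace (hol_topology \<Omega>)" for h
    proof
      assume "(\<lambda>x. h x * h x) \<in> W"
      from W(3)[OF this] have "norm (h z * h z - (z - a)) \<le> r/3" if "z \<in> cball a r" for z
        using that r(2) by (auto simp: g_def subset_iff)
      moreover have "h holomorphic_on \<Omega>" using h by (simp add: topspace_hol_topology hol_funs_def)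
      ultimately show False using square_not_near_simple_zero \<Omega>(1) r by blast
    qed
  qed
qed

section \<open>Solving polynomial equations with smooth functions\<close>

text \<open>
  Local injectivity at each of the finitely many points, with one radius that suits all of them and
  is at most half of every mutual distance.
\<close>

lemma poly_fibre_disjoint_discs:
  fixes p :: "complex poly"
  assumes "finite Z" "\<And>z. z \<in> Z \<Longrightarrow> poly (pderiv p) z \<noteq> 0"
  obtains r where "0 < r" "\<And>z. z \<in> Z \<Longrightarrow> inj_on (poly p) (ball z r)"
    "\<And>y z. y \<in> Z \<Longrightarrow> z \<in> Z \<Longrightarrow> y \<noteq> z \<Longrightarrow> ball y r \<inter> ball z r = {}"
proof -
  have "\<exists>r>0. inj_on (poly p) (ball z r)" if "z \<in> Z" for z
  proof -
    have "deriv (poly p) z \<noteq> 0" using assms(2)[OF that] by (simp add: DERIV_imp_deriv[OF poly_DERIV])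
    moreover have "poly p holomorphic_on UNIV"
      unfolding holomorphic_on_def field_differentiable_def using poly_DERIV by blast
    ultimately show ?thesis
      using has_complex_derivative_locally_injective[of "poly p" UNIV z] by (metis UNIV_I open_UNIV)
  qed
  then obtain R where R: "\<And>z. z \<in> Z \<Longrightarrow> 0 < R z \<and> inj_on (poly p) (ball z (R z))" by metis
  \<comment> \<open>inserting \<open>1\<close> keeps the set nonempty when \<open>Z\<close> is empty\<close>
  define S where "S = insert 1 (R ` Z \<union> (\<lambda>(y, z). dist y z / 2) ` {(y, z) \<in> Z \<times> Z. y \<noteq> z})"
  have "finite {(y, z) \<in> Z \<times> Z. y \<noteq> z}" by (rule finite_subset[of _ "Z \<times> Z"]) (use assms(1) in auto)
  then have S: "finite S" "S \<noteq> {}" using assms(1) by (auto simp: S_def)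
  show ?thesis
  proof
    show "0 < Min S" using S R by (auto simp: S_def)
    show "inj_on (poly p) (ball z (Min S))" if z: "z \<in> Z" for z
    proof -
      have "Min S \<le> R z" using S z by (intro Min_le) (auto simp: S_def)
      then show ?thesis using R[OF z] by (meson inj_on_subset subset_ball)
    qed
    show "ball y (Min S) \<inter> ball z (Min S) = {}" if yz: "y \<in> Z" "z \<in> Z" "y \<noteq> z" for y z
    proof -
      have "dist y z / 2 \<in> S" unfolding S_def using yz by force
      then have "Min S \<le> dist y z / 2" using S by (intro Min_le)
      then show ?thesis by (intro disjoint_ballI) simp
    qed
  qed
qed

lemma card_simple_roots:
  fixes p :: "complex poly"
  assumes "p \<noteq> 0" "\<And>z. poly p z = 0 \<Longrightarrow> poly (pderiv p) z \<noteq> 0"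
  shows "card {z. poly p z = 0} = degree p"
proof -
  have "rsquarefree p" using assms(2) by (auto simp: rsquarefree_roots)
  then have "p = smult (lead_coeff p) (\<Prod>z|poly p z = 0. [:-z, 1:])"
    by (simp add: complex_poly_decompose_rsquarefree)
  then have "degree p = degree (\<Prod>z|poly p z = 0. [:-z, 1:])"
    using assms(1) by (metis degree_smult_eq leading_coeff_0_iff)
  also have "\<dots> = (\<Sum>z|poly p z = 0. degree [:-z, 1:])"
    by (rule degree_prod_sum_eq) auto
  also have "\<dots> = card {z. poly p z = 0}" by simp
  finally show ?thesis ..
qed

definition critical_values :: "complex poly \<Rightarrow> complex set" where
  "critical_values p = poly p ` {z. poly (pderiv p) z = 0}"

lemma finite_critical_values: "0 < degree p \<Longrightarrow> finite (critical_values p)"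
  unfolding critical_values_def
  by (intro finite_imageI poly_roots_finite) (auto simp: pderiv_eq_0_iff)

text \<open>
  A fibre over a noncritical value \<open>w\<close> consists of \<open>degree p\<close> simple roots. Disjoint discs around
  them are mapped injectively, and over the intersection \<open>T\<close> of their images every fibre has a point in
  each disc. These are \<open>degree p\<close> points already, so the discs contain the whole preimage of \<open>T\<close>.
\<close>

lemma covering_space_poly:
  assumes deg: "0 < degree p"
  shows "covering_space (poly p -` (- critical_values p)) (poly p) (- critical_values p)"
proof -
  let ?C = "poly p -` (- critical_values p)" and ?S = "- critical_values p"
  have opS: "open ?S" using finite_critical_values[OF deg] by (simp add: finite_imp_closed open_Compl)
  have opC: "open ?C" by (intro continuous_open_vimage opS continuous_at_imp_continuous_on) auto
  have cont: "continuous_on A (poly p)" for A by (intro continuous_intros)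
  have nc: "p - [:w:] \<noteq> 0" "degree (p - [:w:]) = degree p" for w
  proof -
    show d: "degree (p - [:w:]) = degree p"
      unfolding diff_conv_add_uminus using deg by (intro degree_add_eq_left) simp
    then show "p - [:w:] \<noteq> 0" using deg by auto
  qed
  have fin: "finite {z. poly p z = w}" and card: "card {z. poly p z = w} \<le> degree p" for w
    using poly_roots_finite[OF nc(1)[of w]] card_poly_roots_bound[OF nc(1)[of w]] nc(2)[of w] by simp_all
  have onto: "\<exists>z. poly p z = w" for w
    using Fundamental_Theorem_Algebra.fundamental_theorem_of_algebra[of "p - [:w:]"] nc(2)[of w] deg by (auto simp: constant_degree)
  have local: "\<exists>T. w \<in> T \<and> openin (top_of_set ?S) T \<and>
      (\<exists>v. \<Union>v = ?C \<inter> poly p -` T \<and> (\<forall>u\<in>v. openin (top_of_set ?C) u) \<and> pairwise disjnt v \<and>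
        (\<forall>u\<in>v. \<exists>q. homeomorphism u T (poly p) q))" if w: "w \<in> ?S" for w
  proof -
    let ?Z = "{z. poly p z = w}"
    have simple: "poly (pderiv p) z \<noteq> 0" if "z \<in> ?Z" for z
      using w that by (auto simp: critical_values_def)
    have cardZ: "card ?Z = degree p"
      using card_simple_roots[OF nc(1)[of w]] simple nc(2)[of w] by (simp add: pderiv_diff pderiv_pCons)
    obtain r where r: "0 < r" "\<And>z. z \<in> ?Z \<Longrightarrow> inj_on (poly p) (ball z r)"
      "\<And>y z. y \<in> ?Z \<Longrightarrow> z \<in> ?Z \<Longrightarrow> y \<noteq> z \<Longrightarrow> ball y r \<inter> ball z r = {}"
      using poly_fibre_disjoint_discs[OF fin simple] by metis
    define T where "T = ?S \<inter> (\<Inter>z\<in>?Z. poly p ` ball z r)"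
    define u where "u z = ball z r \<inter> poly p -` T" for z
    have opB: "open (poly p ` ball z r)" if "z \<in> ?Z" for z
      using invariance_of_domain[OF cont open_ball r(2)[OF that]] .
    have opT: "open T" unfolding T_def using fin opB opS by (intro open_Int open_INT) auto
    have wT: "w \<in> T" using w r(1) by (force simp: T_def)
    have opu: "open (u z)" for z unfolding u_def
      by (intro open_Int open_ball continuous_open_vimage opT continuous_at_imp_continuous_on) auto
    have imu: "poly p ` u z = T" if "z \<in> ?Z" for z
    proof -
      have "poly p ` u z = poly p ` ball z r \<inter> T" by (auto simp: u_def)
      moreover have "T \<subseteq> poly p ` ball z r" using that unfolding T_def by blast
      ultimately show ?thesis by blast
    qed
    have Union: "\<Union>(u ` ?Z) = ?C \<inter> poly p -` T"
    proof
      show "\<Union>(u ` ?Z) \<subseteq> ?C \<inter> poly p -` T" by (auto simp: u_def T_def)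
      show "?C \<inter> poly p -` T \<subseteq> \<Union>(u ` ?Z)"
      proof
        fix y assume y: "y \<in> ?C \<inter> poly p -` T"
        let ?Y = "{y'. poly p y' = poly p y}"
        have "\<forall>z\<in>?Z. \<exists>x. x \<in> ball z r \<and> poly p x = poly p y" using y by (force simp: T_def)
        then obtain x where x: "\<And>z. z \<in> ?Z \<Longrightarrow> x z \<in> ball z r \<and> poly p (x z) = poly p y" by metis
        \<comment> \<open>the points \<open>x z\<close> exhaust the fibre of \<open>y\<close>, which has at most \<open>degree p\<close> elements\<close>
        have "inj_on x ?Z" by (rule inj_onI) (metis x r(3) IntI empty_iff)
        then have "card (x ` ?Z) = degree p" using cardZ by (simp add: card_image)
        moreover have "x ` ?Z \<subseteq> ?Y" using x by auto
        ultimately have "x ` ?Z = ?Y" using card[of "poly p y"] fin by (intro card_seteq) auto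
        then obtain z where z: "z \<in> ?Z" "y = x z" by blast
        then have "y \<in> ball z r" using x[OF z(1)] by (simp only:)
        then have "y \<in> u z" using y unfolding u_def by blast
        then show "y \<in> \<Union>(u ` ?Z)" using z(1) by blast
      qed
    qed
    have homeo: "\<exists>q. homeomorphism (u z) T (poly p) q" if z: "z \<in> ?Z" for z
    proof -
      have "inj_on (poly p) (u z)" using r(2)[OF z] by (rule inj_on_subset) (auto simp: u_def)
      then obtain q where "homeomorphism (u z) (poly p ` u z) (poly p) q"
        using invariance_of_domain_homeomorphism[OF opu cont] by blast
      then show ?thesis using imu[OF z] by auto
    qed
    have disj: "pairwise disjnt (u ` ?Z)"
      unfolding pairwise_image by (rule pairwiseI) (use r(3) in \<open>fastforce simp: disjnt_def u_def\<close>)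
    have "openin (top_of_set ?S) T" using opT by (rule open_openin_trans[OF opS]) (auto simp: T_def)
    moreover have "openin (top_of_set ?C) (u z)" if "z \<in> ?Z" for z
      using opu by (intro open_openin_trans[OF opC]) (auto simp: u_def T_def)
    ultimately show ?thesis
      by (intro exI[of _ T] conjI exI[of _ "u ` ?Z"] wT Union disj) (use homeo in blast)+
  qed
  have "range (poly p) = UNIV" using onto by (metis surjI)
  then have "poly p ` ?C = ?S" unfolding image_vimage_eq by simp
  then show ?thesis unfolding covering_space_def by (intro conjI ballI cont local)
qed

lemma has_vector_derivative_iff_quotient:
  "(f has_vector_derivative d) (at x) \<longleftrightarrow> ((\<lambda>t. (f t - f x) /\<^sub>R (t - x)) \<longlongrightarrow> d) (at x)"
proof -
  have eq: "norm ((f t - f x) - (t - x) *\<^sub>R d) / norm (t - x) = norm ((f t - f x) /\<^sub>R (t - x) - d)"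
    if "t \<noteq> x" for t
  proof -
    have "(f t - f x) /\<^sub>R (t - x) - d = ((f t - f x) - (t - x) *\<^sub>R d) /\<^sub>R (t - x)"
      using that by (simp add: scaleR_diff_right)
    then show ?thesis by (simp add: divide_inverse mult.commute)
  qed
  have "(f has_vector_derivative d) (at x) \<longleftrightarrow>
      ((\<lambda>t. norm ((f t - f x) - (t - x) *\<^sub>R d) / norm (t - x)) \<longlongrightarrow> 0) (at x)"
    by (simp add: has_vector_derivative_def has_derivative_iff_norm bounded_linear_scaleR_left)
  also have "\<dots> \<longleftrightarrow> ((\<lambda>t. norm ((f t - f x) /\<^sub>R (t - x) - d)) \<longlongrightarrow> 0) (at x)"
    by (rule tendsto_cong, unfold eventually_at_filter, intro always_eventually allI impI eq)
  also have "\<dots> \<longleftrightarrow> ((\<lambda>t. (f t - f x) /\<^sub>R (t - x)) \<longlongrightarrow> d) (at x)"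
    by (simp only: tendsto_norm_zero_iff LIM_zero_iff)
  finally show ?thesis .
qed

text \<open>
  Write \<open>p z - p (f x) = (z - f x) * q z\<close> with a polynomial \<open>q\<close>, for which \<open>q (f x) = p' (f x) \<noteq> 0\<close>. Then
  the difference quotient of \<open>f\<close> is that of \<open>p \<circ> f\<close> divided by \<open>q \<circ> f\<close>, which converges by
  continuity of \<open>f\<close>.
\<close>

lemma lift_has_vector_derivative:
  fixes f :: "real \<Rightarrow> complex"
  assumes cont: "isCont f x"
    and der: "((\<lambda>t. poly p (f t)) has_vector_derivative g') (at x)"
    and nz: "poly (pderiv p) (f x) \<noteq> 0"
  shows "(f has_vector_derivative g' * inverse (poly (pderiv p) (f x))) (at x)"
proof -
  let ?a = "f x"
  have "[:- ?a, 1:] dvd p - [:poly p ?a:]" by (simp add: poly_eq_0_iff_dvd[symmetric] del: diff_pCons)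
  then obtain q where q: "p - [:poly p ?a:] = [:- ?a, 1:] * q" by (elim dvdE)
  then have p: "p = [:- ?a, 1:] * q + [:poly p ?a:]" by (simp add: algebra_simps del: diff_pCons)
  have eq: "poly p z - poly p ?a = (z - ?a) * poly q z" for z
    using arg_cong[OF q, of "\<lambda>r. poly r z"] by (simp add: algebra_simps)
  have "poly (pderiv p) ?a = poly q ?a"
    by (subst p) (simp add: pderiv_add pderiv_diff pderiv_smult pderiv_mult pderiv_pCons)
  with nz have qa: "poly q ?a \<noteq> 0" "poly (pderiv p) ?a = poly q ?a" by auto
  have contq: "((\<lambda>t. poly q (f t)) \<longlongrightarrow> poly q ?a) (at x)"
    using cont by (intro tendsto_intros) (simp add: isCont_def)
  have lim: "((\<lambda>t. (poly p (f t) - poly p ?a) /\<^sub>R (t - x)) \<longlongrightarrow> g') (at x)"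
    using der by (simp add: has_vector_derivative_iff_quotient)
  have "((\<lambda>t. (poly p (f t) - poly p ?a) /\<^sub>R (t - x) * inverse (poly q (f t))) \<longlongrightarrow> g' * inverse (poly q ?a)) (at x)"
    by (intro tendsto_mult lim tendsto_inverse contq qa)
  moreover have "\<forall>\<^sub>F t in at x. (poly p (f t) - poly p ?a) /\<^sub>R (t - x) * inverse (poly q (f t)) = (f t - ?a) /\<^sub>R (t - x)"
    using tendsto_imp_eventually_ne[OF contq qa(1)] by eventually_elim (simp add: eq)
  ultimately have "((\<lambda>t. (f t - ?a) /\<^sub>R (t - x)) \<longlongrightarrow> g' * inverse (poly q ?a)) (at x)"
    by (rule Lim_transform_eventually)
  then show ?thesis by (simp add: has_vector_derivative_iff_quotient qa(2))
qed

text \<open>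
  Differentiability is bootstrapped through the formula \<open>f' = (p \<circ> f)' / p'(f)\<close>: if \<open>f\<close> is \<open>k\<close> times
  differentiable, then so is the right-hand side.
\<close>

lemma smooth_lift:
  fixes f :: "real \<Rightarrow> complex"
  assumes cont: "continuous_on UNIV f"
    and g: "(\<lambda>x. poly p (f x)) \<in> smooth_funs"
    and nz: "\<And>x. poly (pderiv p) (f x) \<noteq> 0"
  shows "f \<in> smooth_funs"
proof -
  let ?g' = "nth_deriv 1 (\<lambda>x. poly p (f x))"
  have der: "(f has_vector_derivative ?g' x * inverse (poly (pderiv p) (f x))) (at x)" for x
    using cont smooth_has_vector_derivative[OF g, of 0 x]
    by (intro lift_has_vector_derivative nz) (auto simp: continuous_on_eq_continuous_at)
  have "times_differentiable k f" for k
  proof (induction k)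
    case (Suc k)
    have "times_differentiable k ?g'" using smooth_nth_deriv[OF g] by (simp add: smooth_funs_iff)
    then show ?case
      by (intro times_differentiable_SucI[OF der] times_differentiable_mult times_differentiable_inverse
          times_differentiable_poly Suc nz)
  qed simp
  then show ?thesis by (simp add: smooth_funs_iff)
qed

lemma smooth_poly_lift:
  assumes deg: "0 < degree p" and g: "g \<in> smooth_funs" "\<And>x. g x \<notin> critical_values p"
  obtains f where "f \<in> smooth_funs" "\<And>x. poly p (f x) = g x"
proof -
  have cg: "continuous_on UNIV g" using smooth_continuous[OF g(1), of _ 0] by simp
  have sc: "simply_connected (UNIV :: real set)" "locally path_connected (UNIV :: real set)"
    by (simp_all add: convex_imp_simply_connected convex_imp_locally_path_connected)
  have "g \<in> UNIV \<rightarrow> - critical_values p" using g(2) by auto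
  then obtain f where f: "continuous_on UNIV f" "\<And>x. poly p (f x) = g x"
    using covering_space_lift[OF covering_space_poly[OF deg] sc cg] by (metis UNIV_I)
  have "(\<lambda>x. poly p (f x)) = g" using f(2) by auto
  moreover have "poly (pderiv p) (f x) \<noteq> 0" for x
    using g(2)[of x] f(2)[of x] by (force simp: critical_values_def)
  ultimately have "f \<in> smooth_funs" using smooth_lift[OF f(1), of p] g(1) by simp
  then show ?thesis using that f(2) by blast
qed

text \<open>
  The bad constants are the differences \<open>w - g x\<close> with \<open>w \<in> F\<close>. They form finitely many smooth curves
  in the plane, hence a null set, which contains no disc.
\<close>

lemma small_translate_avoids_finite_set:
  fixes g :: "real \<Rightarrow> complex"
  assumes "g \<in> smooth_funs" "finite F" "0 < e"
  obtains c where "norm c < e" "\<And>x. g x + c \<notin> F"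
proof -
  have "g differentiable_on UNIV"
    using smooth_has_vector_derivative[OF assms(1), of 0] differentiableI_vector
    by (auto simp: differentiable_on_def)
  then have "negligible (range (\<lambda>x. w - g x))" for w
    by (intro negligible_differentiable_image_lowdim differentiable_on_diff) auto
  then have "negligible (\<Union>w\<in>F. range (\<lambda>x. w - g x))" using assms(2) by (intro negligible_Union) auto
  then have "\<not> ball 0 e \<subseteq> (\<Union>w\<in>F. range (\<lambda>x. w - g x))"
    using open_not_negligible[of "ball (0::complex) e"] assms(3) negligible_subset by auto
  then obtain c where "c \<in> ball 0 e" "\<And>w x. w \<in> F \<Longrightarrow> c \<noteq> w - g x" by blast
  then show ?thesis by (intro that[of c]) (auto simp: eq_diff_eq add.commute)
qed

lemma poly_range_dense:
  fixes p :: "complex poly"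
  assumes "0 < degree p" "openin smooth_topology U" "U \<noteq> {}"
  obtains f where "f \<in> smooth_funs" "(\<lambda>x. poly p (f x)) \<in> U"
proof -
  obtain g n e where g: "g \<in> smooth_funs" "0 < e" "smooth_nbhd n e g \<subseteq> U"
    using assms(2,3) unfolding openin_smooth_topology by blast
  obtain c where c: "norm c < e" "\<And>x. g x + c \<notin> critical_values p"
    using small_translate_avoids_finite_set[OF g(1) finite_critical_values[OF assms(1)] g(2)] by blast
  obtain f where f: "f \<in> smooth_funs" "\<And>x. poly p (f x) = g x + c"
    using smooth_poly_lift[OF assms(1) smooth_add[OF g(1) smooth_const] c(2)] by blast
  have "(\<lambda>x. poly p (f x)) \<in> smooth_nbhd n e g"
    using c(1) g(1,2) by (auto simp: f(2) smooth_nbhd_def smooth_add deriv_bound_def nth_deriv_const)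
  then show ?thesis using that f(1) g(3) by blast
qed

section \<open>Hypercyclic sequences of vectors\<close>

definition hits :: "('v \<Rightarrow> 'v) \<Rightarrow> nat \<Rightarrow> 'v set \<Rightarrow> 'v set \<Rightarrow> bool" where
  "hits T n U V \<longleftrightarrow> (\<exists>x\<in>U. (T ^^ n) x \<in> V)"

text \<open>
  Topological transitivity of \<open>T \<times> T\<close>, tested on products of open sets.
\<close>

definition pairwise_transitive :: "'v topology \<Rightarrow> ('v \<Rightarrow> 'v) \<Rightarrow> bool" where
  "pairwise_transitive X T \<longleftrightarrow>
     (\<forall>U V U' V'. openin X U \<and> U \<noteq> {} \<and> openin X V \<and> V \<noteq> {} \<and> openin X U' \<and> U' \<noteq> {} \<and> openin X V' \<and> V' \<noteq> {} \<longrightarrow>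
       (\<exists>n. hits T n U V \<and> hits T n U' V'))"

lemma continuous_map_funpow:
  assumes "continuous_map X X T"
  shows "continuous_map X X (T ^^ n)"
proof (induction n)
  case (Suc n)
  show ?case unfolding funpow.simps by (rule continuous_map_compose[OF Suc assms])
qed (simp add: id_def[symmetric])

text \<open>
  Furstenberg's argument. The return times from \<open>U\<close> to \<open>V\<close> and from \<open>U\<^sub>1\<close> to \<open>V\<^sub>1\<close> have a common subset
  of the same kind: choose \<open>m\<close> that leads from \<open>U\<close> to \<open>U\<^sub>1\<close> and from \<open>V\<close> to \<open>V\<^sub>1\<close>; then every return
  time from \<open>U \<inter> T\<^sup>-\<^sup>m U\<^sub>1\<close> to \<open>V \<inter> T\<^sup>-\<^sup>m V\<^sub>1\<close> lies in both sets, because \<open>T\<^sup>m\<close> commutes with \<open>T\<^sup>n\<close>. By induction,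
  finitely many sets of return times contain a common one.
\<close>

lemma pairwise_transitive_finite:
  fixes N :: nat
  assumes T: "continuous_map X X T" and pt: "pairwise_transitive X T"
    and X: "topspace X \<noteq> {}"
    and U: "\<And>i. i < N \<Longrightarrow> openin X (U i) \<and> U i \<noteq> {}"
    and V: "\<And>i. i < N \<Longrightarrow> openin X (V i) \<and> V i \<noteq> {}"
  shows "\<exists>n. \<forall>i<N. hits T n (U i) (V i)"
proof -
  have "\<exists>U' V'. openin X U' \<and> U' \<noteq> {} \<and> openin X V' \<and> V' \<noteq> {} \<and>
          (\<forall>n. hits T n U' V' \<longrightarrow> (\<forall>i<M. hits T n (U i) (V i)))" if "M \<le> N" for M
    using that
  proof (induction M)
    case 0
    show ?case using X by (intro exI[of _ "topspace X"]) auto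
  next
    case (Suc M)
    then obtain U' V' where UV: "openin X U'" "U' \<noteq> {}" "openin X V'" "V' \<noteq> {}"
      "\<And>n. hits T n U' V' \<Longrightarrow> \<forall>i<M. hits T n (U i) (V i)" by auto
    have UVM: "openin X (U M) \<and> U M \<noteq> {}" "openin X (V M) \<and> V M \<noteq> {}"
      using U[of M] V[of M] Suc.prems by auto
    then obtain m where m: "hits T m U' (U M)" "hits T m V' (V M)"
      using pt UV unfolding pairwise_transitive_def by meson
    let ?U = "U' \<inter> {x \<in> topspace X. (T ^^ m) x \<in> U M}" and ?V = "V' \<inter> {x \<in> topspace X. (T ^^ m) x \<in> V M}"
    have "openin X ?U" "openin X ?V"
      using UVM by (auto intro!: openin_Int UV openin_continuous_map_preimage[OF continuous_map_funpow[OF T]])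
    moreover have "?U \<noteq> {}" "?V \<noteq> {}"
      using m openin_subset[OF UV(1)] openin_subset[OF UV(3)] unfolding hits_def by blast+
    moreover have "hits T n (U i) (V i)" if h: "hits T n ?U ?V" and i: "i < Suc M" for n i
    proof (cases "i = M")
      case True
      have "(T ^^ m) ((T ^^ n) x) = (T ^^ n) ((T ^^ m) x)" for x
        by (metis add.commute comp_apply funpow_add)
      then show ?thesis using h True by (auto simp: hits_def)
    next
      case False
      then show ?thesis using UV(5)[of n] h i by (auto simp: hits_def less_Suc_eq)
    qed
    ultimately show ?case by (intro exI[of _ ?U] exI[of _ ?V]) blast
  qed
  from this[of N] obtain U' V' where "openin X U'" "U' \<noteq> {}" "openin X V'" "V' \<noteq> {}"
      "\<And>n. hits T n U' V' \<Longrightarrow> \<forall>i<N. hits T n (U i) (V i)" by blast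
  then show ?thesis using pt unfolding pairwise_transitive_def by meson
qed

text \<open>
  Balls of radius \<open>1 / Suc k\<close> around the points of a countable dense set.
\<close>

lemma countable_pi_base:
  assumes "metrizable_space X" "countable D" "X closure_of D = topspace X"
  obtains \<B> where "countable \<B>" "\<And>b. b \<in> \<B> \<Longrightarrow> openin X b \<and> b \<noteq> {}"
    "\<And>U. openin X U \<Longrightarrow> U \<noteq> {} \<Longrightarrow> \<exists>b\<in>\<B>. b \<subseteq> U"
proof -
  obtain M d where "Metric_space M d" and X: "X = Metric_space.mtopology M d"
    using assms(1) by (auto simp: metrizable_space_def)
  interpret Metric_space M d by fact
  let ?B = "(\<lambda>(x, k). mball x (1 / real (Suc k))) ` ((D \<inter> M) \<times> UNIV)"
  show thesis
  proof
    show "countable ?B" using assms(2) by auto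
    show "openin X b \<and> b \<noteq> {}" if "b \<in> ?B" for b
      using that centre_in_mball_iff by (fastforce simp: X simp del: of_nat_Suc)
    show "\<exists>b\<in>?B. b \<subseteq> U" if U: "openin X U" "U \<noteq> {}" for U
    proof -
      obtain x where x: "x \<in> D" "x \<in> U"
        using assms(3) U unfolding dense_intersects_open by blast
      then obtain r where r: "r > 0" "mball x r \<subseteq> U" "x \<in> M"
        using U unfolding X openin_mtopology by blast
      obtain k where "1 / real (Suc k) < r" using r(1) nat_approx_posE by blast
      then have "mball x (1 / real (Suc k)) \<subseteq> U" using r mball_subset_concentric[of "1 / real (Suc k)" r x] by auto
      then show ?thesis using x r by (intro bexI[of _ "mball x (1 / real (Suc k))"]) auto
    qed
  qed
qed

abbreviation seq_topology :: "'v topology \<Rightarrow> (nat \<Rightarrow> 'v) topology" where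
  "seq_topology X \<equiv> product_topology (\<lambda>_. X) UNIV"

text \<open>
  Both requirements on the sequence are countable intersections of open sets of the complete
  metrizable space of sequences, indexed by the members of a countable family of test sets or by
  finite lists of them. An open box of that space constrains only finitely many coordinates. Hence
  finite transitivity makes the sets for the dense orbit dense, and an unconstrained coordinate, free
  to enter the test set, does so for the sets that make the members of the sequence dense in \<open>X\<close>.
  The Baire category theorem gives a common point.
\<close>

lemma dense_orbit_in_sequence_space:
  assumes X: "completely_metrizable_space X" "topspace X \<noteq> {}"
    and D: "countable D" "X closure_of D = topspace X"
    and T: "continuous_map X X T" "pairwise_transitive X T"
  obtains f where "X closure_of (range f) = topspace X"
    "f \<in> topspace (seq_topology X)"
    "seq_topology X closure_of (range (\<lambda>n i. (T ^^ n) (f i))) = topspace (seq_topology X)"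
proof -
  obtain \<B> where \<B>: "countable \<B>" "\<And>b. b \<in> \<B> \<Longrightarrow> openin X b \<and> b \<noteq> {}"
    "\<And>U. openin X U \<Longrightarrow> U \<noteq> {} \<Longrightarrow> \<exists>b\<in>\<B>. b \<subseteq> U"
    using countable_pi_base[OF completely_metrizable_imp_metrizable_space[OF X(1)] D] by blast
  let ?Y = "seq_topology X"
  have topY: "f \<in> topspace ?Y \<longleftrightarrow> (\<forall>i. f i \<in> topspace X)" for f by auto
  have Tn: "(T ^^ n) x \<in> topspace X" if "x \<in> topspace X" for n x
    using continuous_map_funspace[OF continuous_map_funpow[OF T(1)]] that by blast
  have box: "\<exists>U. finite {i. U i \<noteq> topspace X} \<and> (\<forall>i. openin X (U i) \<and> g i \<in> U i) \<and>
               (\<forall>h. (\<forall>i. h i \<in> U i) \<longrightarrow> h \<in> W)" if gW: "openin ?Y W" "g \<in> W" for W g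
    using that unfolding openin_product_topology_alt by (auto simp: PiE_iff subset_iff) meson
  define G where "G bs = {f \<in> topspace ?Y. \<exists>n. \<forall>i<length bs. (T ^^ n) (f i) \<in> bs ! i}" for bs
  define H where "H b = {f \<in> topspace ?Y. \<exists>i. f i \<in> b}" for b
  have coord: "openin ?Y {f \<in> topspace ?Y. (T ^^ n) (f i) \<in> b}" if "openin X b" for n i b
    by (rule openin_continuous_map_preimage[OF _ that])
       (rule continuous_map_compose[unfolded o_def, OF _ continuous_map_funpow[OF T(1)]],
        rule continuous_map_product_projection, simp)
  have G_open: "openin ?Y (G bs)" if "bs \<in> lists \<B>" for bs
  proof -
    have "openin ?Y {f \<in> topspace ?Y. \<forall>i<m. (T ^^ n) (f i) \<in> bs ! i}" if "m \<le> length bs" for n m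
      using that
    proof (induction m)
      case 0
      show ?case using openin_topspace[of ?Y] by (simp only: less_nat_zero_code) simp
    next
      case (Suc m)
      have "openin X (bs ! m)" using Suc.prems \<open>bs \<in> lists \<B>\<close> \<B>(2) by (metis in_lists_conv_set nth_mem Suc_le_eq)
      from openin_Int[OF Suc.IH coord[OF this]] Suc.prems
      have "openin ?Y ({f \<in> topspace ?Y. \<forall>i<m. (T ^^ n) (f i) \<in> bs ! i} \<inter> {f \<in> topspace ?Y. (T ^^ n) (f m) \<in> bs ! m})"
        by simp
      also have "({f \<in> topspace ?Y. \<forall>i<m. (T ^^ n) (f i) \<in> bs ! i} \<inter> {f \<in> topspace ?Y. (T ^^ n) (f m) \<in> bs ! m})
        = {f \<in> topspace ?Y. \<forall>i<Suc m. (T ^^ n) (f i) \<in> bs ! i}"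
        by (auto simp: less_Suc_eq)
      finally show ?case .
    qed
    from openin_Union[of "range (\<lambda>n. {f \<in> topspace ?Y. \<forall>i<length bs. (T ^^ n) (f i) \<in> bs ! i})", OF _ ] this[of "length bs"]
    have "openin ?Y (\<Union>n. {f \<in> topspace ?Y. \<forall>i<length bs. (T ^^ n) (f i) \<in> bs ! i})" by blast
    also have "(\<Union>n. {f \<in> topspace ?Y. \<forall>i<length bs. (T ^^ n) (f i) \<in> bs ! i}) = G bs"
      by (auto simp: G_def)
    finally show ?thesis .
  qed
  have G_dense: "?Y closure_of (G bs) = topspace ?Y" if bs: "bs \<in> lists \<B>" for bs
    unfolding dense_intersects_open
  proof (intro allI impI)
    fix W assume "openin ?Y W \<and> W \<noteq> {}"
    then obtain g where g: "openin ?Y W" "g \<in> W" by blast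
    obtain U where U: "\<And>i. openin X (U i) \<and> g i \<in> U i" "\<And>h. (\<And>i. h i \<in> U i) \<Longrightarrow> h \<in> W"
      using box[OF g] by blast
    have "openin X (bs ! i) \<and> bs ! i \<noteq> {}" if "i < length bs" for i
      using bs \<B>(2) that by (metis in_lists_conv_set nth_mem)
    then obtain n where "\<forall>i<length bs. hits T n (U i) (bs ! i)"
      using pairwise_transitive_finite[OF T X(2), of "length bs" U "(!) bs"] U(1) by blast
    then obtain x where x: "\<And>i. i < length bs \<Longrightarrow> x i \<in> U i \<and> (T ^^ n) (x i) \<in> bs ! i"
      unfolding hits_def by metis
    define f where "f i = (if i < length bs then x i else g i)" for i
    have "f \<in> W" using x U by (intro U(2)) (auto simp: f_def)
    moreover have "f \<in> G bs"
      unfolding G_def using \<open>f \<in> W\<close> openin_subset[OF g(1)] x by (auto simp: f_def intro!: exI[of _ n])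
    ultimately show "G bs \<inter> W \<noteq> {}" by blast
  qed
  have H_open: "openin ?Y (H b)" if "b \<in> \<B>" for b
  proof -
    have "openin ?Y (\<Union>i. {f \<in> topspace ?Y. (T ^^ 0) (f i) \<in> b})"
      using coord \<B>(2)[OF that] by blast
    also have "(\<Union>i. {f \<in> topspace ?Y. (T ^^ 0) (f i) \<in> b}) = H b" by (auto simp: H_def)
    finally show ?thesis .
  qed
  have H_dense: "?Y closure_of (H b) = topspace ?Y" if b: "b \<in> \<B>" for b
    unfolding dense_intersects_open
  proof (intro allI impI)
    fix W assume "openin ?Y W \<and> W \<noteq> {}"
    then obtain g where g: "openin ?Y W" "g \<in> W" by blast
    obtain U where U: "finite {i. U i \<noteq> topspace X}" "\<And>i. openin X (U i) \<and> g i \<in> U i" "\<And>h. (\<And>i. h i \<in> U i) \<Longrightarrow> h \<in> W"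
      using box[OF g] by blast
    obtain i where i: "U i = topspace X" using ex_new_if_finite[OF infinite_UNIV_nat U(1)] by auto
    obtain x where x: "x \<in> b" "x \<in> topspace X" using \<B>(2)[OF b] openin_subset by fastforce
    have "g(i := x) \<in> W" using U x i by (intro U(3)) auto
    moreover have "g(i := x) \<in> H b"
      unfolding H_def using \<open>g(i := x) \<in> W\<close> openin_subset[OF g(1)] x by (auto intro!: exI[of _ i])
    ultimately show "H b \<inter> W \<noteq> {}" by blast
  qed
  let ?\<G> = "G ` lists \<B> \<union> H ` \<B>"
  have "?Y closure_of \<Inter>?\<G> = topspace ?Y"
  proof (rule Baire_category)
    show "completely_metrizable_space ?Y \<or> locally_compact_space ?Y \<and> regular_space ?Y"
      using X(1) by (simp add: completely_metrizable_space_product_topology)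
    show "countable ?\<G>" using \<B>(1) by (intro countable_Un countable_image) auto
    show "openin ?Y S \<and> ?Y closure_of S = topspace ?Y" if "S \<in> ?\<G>" for S
      using that G_open G_dense H_open H_dense by blast
  qed
  moreover have "topspace ?Y \<noteq> {}"
  proof -
    obtain x where "x \<in> topspace X" using X(2) by blast
    then have "(\<lambda>_. x) \<in> topspace ?Y" by (simp add: PiE_UNIV_domain)
    then show ?thesis by blast
  qed
  ultimately have "\<Inter>?\<G> \<noteq> {}" by auto
  then obtain f where fG: "\<And>bs. bs \<in> lists \<B> \<Longrightarrow> f \<in> G bs" and fH: "\<And>b. b \<in> \<B> \<Longrightarrow> f \<in> H b" by blast
  show thesis
  proof
    show fY: "f \<in> topspace ?Y" using fG[of "[]"] by (simp add: G_def)
    show "X closure_of (range f) = topspace X"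
      unfolding dense_intersects_open
    proof (intro allI impI)
      fix U assume "openin X U \<and> U \<noteq> {}"
      then obtain b where "b \<in> \<B>" "b \<subseteq> U" using \<B>(3) by blast
      then show "range f \<inter> U \<noteq> {}" using fH[of b] by (auto simp: H_def)
    qed
    show "?Y closure_of (range (\<lambda>n i. (T ^^ n) (f i))) = topspace ?Y"
      unfolding dense_intersects_open
    proof (intro allI impI)
      fix W assume "openin ?Y W \<and> W \<noteq> {}"
      then obtain g where g: "openin ?Y W" "g \<in> W" by blast
      obtain U where U: "finite {i. U i \<noteq> topspace X}" "\<And>i. openin X (U i) \<and> g i \<in> U i" "\<And>h. (\<And>i. h i \<in> U i) \<Longrightarrow> h \<in> W"
        using box[OF g] by blast
      obtain N where N: "\<And>i. U i \<noteq> topspace X \<Longrightarrow> i < N" using U(1) finite_nat_set_iff_bounded by auto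
      have "\<forall>i. \<exists>b\<in>\<B>. b \<subseteq> U i" using U(2) by (intro allI \<B>(3)) auto
      then obtain b where b: "\<And>i. b i \<in> \<B> \<and> b i \<subseteq> U i" by metis
      have "f \<in> G (map b [0..<N])" using b by (intro fG) (auto simp: lists_eq_set)
      then obtain n where n: "\<And>i. i < N \<Longrightarrow> (T ^^ n) (f i) \<in> b i" by (auto simp: G_def)
      have "(T ^^ n) (f i) \<in> U i" for i
        using n[of i] b[of i] N[of i] Tn[of "f i" n] fY unfolding topY by (cases "i < N") auto
      then have "(\<lambda>i. (T ^^ n) (f i)) \<in> W" by (intro U(3)) auto
      then show "range (\<lambda>n i. (T ^^ n) (f i)) \<inter> W \<noteq> {}" by blast
    qed
  qed
qed

section \<open>The algebra generated by a hypercyclic sequence\<close>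

text \<open>
  The polynomials without constant term in variables indexed by \<open>nat\<close>, as functions of the
  sequence of their arguments. Substituting a sequence of functions yields the elements of the
  algebra generated by them.
\<close>

inductive_set poly_map :: "((nat \<Rightarrow> complex) \<Rightarrow> complex) set" where
  zero: "(\<lambda>a. 0) \<in> poly_map"
| coord: "(\<lambda>a. a i) \<in> poly_map"
| add: "\<phi> \<in> poly_map \<Longrightarrow> \<psi> \<in> poly_map \<Longrightarrow> (\<lambda>a. \<phi> a + \<psi> a) \<in> poly_map"
| scale: "\<phi> \<in> poly_map \<Longrightarrow> (\<lambda>a. c * \<phi> a) \<in> poly_map"
| mult: "\<phi> \<in> poly_map \<Longrightarrow> \<psi> \<in> poly_map \<Longrightarrow> (\<lambda>a. \<phi> a * \<psi> a) \<in> poly_map"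

lemma poly_map_restrict_to_line:
  "\<phi> \<in> poly_map \<Longrightarrow> \<exists>p. poly p 0 = 0 \<and> (\<forall>t. \<phi> (\<lambda>i. t * c i) = poly p t)"
proof (induction rule: poly_map.induct)
  case zero
  show ?case by (rule exI[of _ 0]) simp
next
  case (coord i)
  show ?case by (rule exI[of _ "[:0, c i:]"]) simp
next
  case (add \<phi> \<psi>)
  then obtain p q where "poly p 0 = 0" "poly q 0 = 0" "\<forall>t. \<phi> (\<lambda>i. t * c i) = poly p t" "\<forall>t. \<psi> (\<lambda>i. t * c i) = poly q t" by blast
  then show ?case by (intro exI[of _ "p + q"]) simp
next
  case (scale \<phi> b)
  then obtain p where "poly p 0 = 0" "\<forall>t. \<phi> (\<lambda>i. t * c i) = poly p t" by blast
  then show ?case by (intro exI[of _ "smult b p"]) simp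
next
  case (mult \<phi> \<psi>)
  then obtain p q where "poly p 0 = 0" "poly q 0 = 0" "\<forall>t. \<phi> (\<lambda>i. t * c i) = poly p t" "\<forall>t. \<psi> (\<lambda>i. t * c i) = poly q t" by blast
  then show ?case by (intro exI[of _ "p * q"]) simp
qed

lemma poly_map_zero: "\<phi> \<in> poly_map \<Longrightarrow> \<phi> (\<lambda>i. 0) = 0"
  by (induction rule: poly_map.induct) auto

text \<open>
  The semantic counterpart of the fact that only variables with index below \<open>N\<close> occur.
\<close>

definition depends_below :: "nat \<Rightarrow> ((nat \<Rightarrow> complex) \<Rightarrow> complex) \<Rightarrow> bool" where
  "depends_below N \<phi> \<longleftrightarrow> (\<forall>a b. (\<forall>i<N. a i = b i) \<longrightarrow> \<phi> a = \<phi> b)"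

lemma depends_below_mono: "depends_below M \<phi> \<Longrightarrow> M \<le> N \<Longrightarrow> depends_below N \<phi>"
  unfolding depends_below_def by (meson order.strict_trans2)

lemma poly_map_depends_below: "\<phi> \<in> poly_map \<Longrightarrow> \<exists>N. depends_below N \<phi>"
proof (induction rule: poly_map.induct)
  case zero
  show ?case by (simp add: depends_below_def)
next
  case (coord i)
  show ?case by (rule exI[of _ "Suc i"]) (auto simp: depends_below_def)
next
  case (scale \<phi> c)
  then obtain N where "depends_below N \<phi>" by blast
  then have "depends_below N (\<lambda>a. c * \<phi> a)" unfolding depends_below_def by metis
  then show ?case by blast
next
  case (add \<phi> \<psi>)
  then obtain M N where "depends_below M \<phi>" "depends_below N \<psi>" by blast
  then have "depends_below (max M N) \<phi>" "depends_below (max M N) \<psi>" by (auto intro: depends_below_mono)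
  then show ?case unfolding depends_below_def by metis
next
  case (mult \<phi> \<psi>)
  then obtain M N where "depends_below M \<phi>" "depends_below N \<psi>" by blast
  then have "depends_below (max M N) \<phi>" "depends_below (max M N) \<psi>" by (auto intro: depends_below_mono)
  then show ?case unfolding depends_below_def by metis
qed

lemma poly_map_smooth:
  assumes "\<And>i. f i \<in> smooth_funs"
  shows "\<phi> \<in> poly_map \<Longrightarrow> (\<lambda>x. \<phi> (\<lambda>i. f i x)) \<in> smooth_funs"
  by (induction rule: poly_map.induct) (auto intro: assms smooth_add smooth_mult)

text \<open>
  A multiplicative operator commutes with polynomials without constant term. Constants must be excluded, since
  \<open>T\<close> may fail to fix the function \<open>1\<close>.
\<close>

lemma poly_map_operator:
  assumes T: "multiplicative_operator UNIV smooth_topology T" and f: "\<And>i. f i \<in> smooth_funs"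
  shows "\<phi> \<in> poly_map \<Longrightarrow> T (\<lambda>x. \<phi> (\<lambda>i. f i x)) = (\<lambda>x. \<phi> (\<lambda>i. T (f i) x))"
proof (induction rule: poly_map.induct)
  have T_add: "T (\<lambda>x. g x + h x) = (\<lambda>x. T g x + T h x)"
    and T_mult: "T (\<lambda>x. g x * h x) = (\<lambda>x. T g x * T h x)" if "g \<in> smooth_funs" "h \<in> smooth_funs" for g h
    using T that by (simp_all add: multiplicative_operator_def operator_on_def topspace_smooth_topology)
  have T_scale: "T (\<lambda>x. c * g x) = (\<lambda>x. c * T g x)" if "g \<in> smooth_funs" for c g
    using T that by (simp add: multiplicative_operator_def operator_on_def topspace_smooth_topology)
  note smooth = poly_map_smooth[where f = f, OF f]
  {
    case zero
    show ?case using T_scale[OF smooth_const[of 0], of 0] by simp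
  next
    case (coord i)
    show ?case by simp
  next
    case (add \<phi> \<psi>)
    then show ?case using T_add[OF smooth[OF add.hyps(1)] smooth[OF add.hyps(2)]] by simp
  next
    case (scale \<phi> c)
    then show ?case using T_scale[OF smooth[OF scale.hyps]] by simp
  next
    case (mult \<phi> \<psi>)
    then show ?case using T_mult[OF smooth[OF mult.hyps(1)] smooth[OF mult.hyps(2)]] by simp
  }
qed

lemma multiplicative_operator_smooth:
  fixes T :: "(real \<Rightarrow> complex) \<Rightarrow> (real \<Rightarrow> complex)"
  shows "multiplicative_operator UNIV smooth_topology T \<Longrightarrow> f \<in> smooth_funs \<Longrightarrow> (T ^^ n) f \<in> smooth_funs"
  using multiplicative_funpow_square(1)[of UNIV smooth_topology T f n]
  by (simp add: topspace_smooth_topology smooth_mult)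

lemma poly_map_funpow:
  assumes T: "multiplicative_operator UNIV smooth_topology T" and f: "\<And>i. f i \<in> smooth_funs"
    and \<phi>: "\<phi> \<in> poly_map"
  shows "(T ^^ n) (\<lambda>x. \<phi> (\<lambda>i. f i x)) = (\<lambda>x. \<phi> (\<lambda>i. (T ^^ n) (f i) x))"
proof (induction n)
  case (Suc n)
  then show ?case
    using poly_map_operator[where f = "\<lambda>i. (T ^^ n) (f i)", OF T multiplicative_operator_smooth[OF T f] \<phi>] by simp
qed simp

lemma continuous_map_poly_map:
  assumes "\<phi> \<in> poly_map"
  shows "continuous_map (seq_topology smooth_topology) smooth_topology (\<lambda>f x. \<phi> (\<lambda>i. f i x))"
  using assms
proof (induction rule: poly_map.induct)
  case zero
  show ?case by (simp add: topspace_smooth_topology)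
next
  case (coord i)
  show ?case using continuous_map_product_projection[of i UNIV "\<lambda>_. smooth_topology"] by (simp add: eta_contract_eq)
next
  case (add \<phi> \<psi>)
  from continuous_map_compose[OF continuous_map_pairedI[OF add.IH] continuous_map_smooth_add]
  show ?case by (simp add: o_def)
next
  case (scale \<phi> c)
  have "continuous_map (seq_topology smooth_topology) smooth_topology (\<lambda>f x. c)"
    by (simp add: topspace_smooth_topology)
  from continuous_map_compose[OF continuous_map_pairedI[OF this scale.IH] continuous_map_smooth_mult]
  show ?case by (simp add: o_def)
next
  case (mult \<phi> \<psi>)
  from continuous_map_compose[OF continuous_map_pairedI[OF mult.IH] continuous_map_smooth_mult]
  show ?case by (simp add: o_def)
qed

text \<open>
  For \<open>P = poly_map\<close> this is the algebra generated by all \<open>f i\<close>; restricting \<open>P\<close> to polynomials in the first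
  \<open>N\<close> variables gives the subalgebras that exhaust it.
\<close>

definition generated_algebra ::
  "(nat \<Rightarrow> real \<Rightarrow> complex) \<Rightarrow> ((nat \<Rightarrow> complex) \<Rightarrow> complex) set \<Rightarrow> (real \<Rightarrow> complex) set" where
  "generated_algebra f P = (\<lambda>\<phi> x. \<phi> (\<lambda>i. f i x)) ` P"

lemma fun_subalgebra_generated:
  assumes f: "\<And>i. f i \<in> smooth_funs" and P: "P \<subseteq> poly_map" "(\<lambda>a. 0) \<in> P"
    and closed: "\<And>\<phi> c. \<phi> \<in> P \<Longrightarrow> (\<lambda>a. c * \<phi> a) \<in> P"
      "\<And>\<phi> \<psi>. \<phi> \<in> P \<Longrightarrow> \<psi> \<in> P \<Longrightarrow> (\<lambda>a. \<phi> a + \<psi> a) \<in> P"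
      "\<And>\<phi> \<psi>. \<phi> \<in> P \<Longrightarrow> \<psi> \<in> P \<Longrightarrow> (\<lambda>a. \<phi> a * \<psi> a) \<in> P"
  shows "fun_subalgebra UNIV smooth_topology (generated_algebra f P)"
proof -
  have mem: "(\<lambda>x. \<phi> (\<lambda>i. f i x)) \<in> generated_algebra f P" if "\<phi> \<in> P" for \<phi>
    using that by (auto simp: generated_algebra_def)
  have "generated_algebra f P \<subseteq> smooth_funs"
    unfolding generated_algebra_def using P(1) poly_map_smooth[of f, OF f] by blast
  moreover have "(\<lambda>x. c * g x) \<in> generated_algebra f P" if "g \<in> generated_algebra f P" for c g
    using that mem[OF closed(1)] unfolding generated_algebra_def[of f P] by blast
  moreover have "(\<lambda>x. g x + h x) \<in> generated_algebra f P" "(\<lambda>x. g x * h x) \<in> generated_algebra f P"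
    if gh: "g \<in> generated_algebra f P" "h \<in> generated_algebra f P" for g h
  proof -
    from gh obtain \<phi> \<psi> where "\<phi> \<in> P" "\<psi> \<in> P" "g = (\<lambda>x. \<phi> (\<lambda>i. f i x))" "h = (\<lambda>x. \<psi> (\<lambda>i. f i x))"
      unfolding generated_algebra_def by blast
    then show "(\<lambda>x. g x + h x) \<in> generated_algebra f P" "(\<lambda>x. g x * h x) \<in> generated_algebra f P"
      using mem[OF closed(2)] mem[OF closed(3)] by simp_all
  qed
  ultimately show ?thesis
    unfolding fun_subalgebra_def topspace_smooth_topology using mem[OF P(2)] by blast
qed

lemma fun_subalgebra_generated_all:
  "(\<And>i. f i \<in> smooth_funs) \<Longrightarrow> fun_subalgebra UNIV smooth_topology (generated_algebra f poly_map)"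
  by (rule fun_subalgebra_generated) (auto intro: poly_map.intros)

lemma fun_subalgebra_generated_below:
  "(\<And>i. f i \<in> smooth_funs) \<Longrightarrow>
     fun_subalgebra UNIV smooth_topology (generated_algebra f {\<phi> \<in> poly_map. depends_below N \<phi>})"
  by (rule fun_subalgebra_generated) (auto intro!: poly_map.intros simp: depends_below_def, metis+)

text \<open>
  Since \<open>\<phi>\<close> does not vanish at some point \<open>c\<close>, it restricts to a nonconstant polynomial \<open>p\<close> on the line
  through \<open>c\<close>. For a given open set choose \<open>h\<close> with \<open>p \<circ> h\<close> in it; then the open set of all sequences that
  \<open>\<phi>\<close> maps into it contains the sequence of functions \<open>c\<^sub>i h\<close>, and is met by the dense orbit.
\<close>

lemma poly_map_hypercyclic:
  assumes T: "multiplicative_operator UNIV smooth_topology T" and f: "\<And>i. f i \<in> smooth_funs"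
    and orbit: "seq_topology smooth_topology closure_of (range (\<lambda>n i. (T ^^ n) (f i))) = topspace (seq_topology smooth_topology)"
    and \<phi>: "\<phi> \<in> poly_map" and nz: "(\<lambda>x. \<phi> (\<lambda>i. f i x)) \<noteq> (\<lambda>x. 0)"
  shows "hypercyclic_vector smooth_topology T (\<lambda>x. \<phi> (\<lambda>i. f i x))"
  unfolding hypercyclic_vector_def dense_intersects_open
proof (intro conjI allI impI)
  show "(\<lambda>x. \<phi> (\<lambda>i. f i x)) \<in> topspace smooth_topology"
    unfolding topspace_smooth_topology by (rule poly_map_smooth[OF f \<phi>])
  fix U :: "(real \<Rightarrow> complex) set" assume U: "openin smooth_topology U \<and> U \<noteq> {}"
  obtain x where x: "\<phi> (\<lambda>i. f i x) \<noteq> 0" using nz by auto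
  define c where "c = (\<lambda>i. f i x)"
  obtain p where p: "poly p 0 = 0" "\<And>t. \<phi> (\<lambda>i. t * c i) = poly p t"
    using poly_map_restrict_to_line[OF \<phi>] by blast
  have "poly p 1 \<noteq> 0" using x p(2)[of 1] by (simp add: c_def)
  have "0 < degree p"
  proof (rule ccontr)
    assume "\<not> 0 < degree p"
    then obtain b where "p = [:b:]" by (auto elim: degree_eq_zeroE)
    then show False using p(1) \<open>poly p 1 \<noteq> 0\<close> by simp
  qed
  then obtain h where h: "h \<in> smooth_funs" "(\<lambda>x. poly p (h x)) \<in> U"
    using poly_range_dense U by blast
  let ?W = "{g \<in> topspace (seq_topology smooth_topology). (\<lambda>x. \<phi> (\<lambda>i. g i x)) \<in> U}"
  have "openin (seq_topology smooth_topology) ?W"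
    using continuous_map_poly_map[OF \<phi>] U by (intro openin_continuous_map_preimage) auto
  moreover have "(\<lambda>i x. h x * c i) \<in> ?W"
    using h(1) h(2) by (simp add: p(2) PiE_UNIV_domain topspace_smooth_topology smooth_mult)
  ultimately have "range (\<lambda>n i. (T ^^ n) (f i)) \<inter> ?W \<noteq> {}"
    using orbit unfolding dense_intersects_open by blast
  then obtain n where "(\<lambda>x. \<phi> (\<lambda>i. (T ^^ n) (f i) x)) \<in> U" by blast
  then show "range (\<lambda>n. (T ^^ n) (\<lambda>x. \<phi> (\<lambda>i. f i x))) \<inter> U \<noteq> {}"
    unfolding poly_map_funpow[OF T f \<phi>, symmetric] by blast
qed

text \<open>
  Such a relation would hold along the whole orbit, which is dense, and hence for all
  sequences of smooth functions. It fails for the sequence whose only nonzero member is the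
  constant function \<open>1\<close> at index \<open>N\<close>.
\<close>

lemma generator_not_in_previous:
  assumes T: "multiplicative_operator UNIV smooth_topology T" and f: "\<And>i. f i \<in> smooth_funs"
    and orbit: "seq_topology smooth_topology closure_of (range (\<lambda>n i. (T ^^ n) (f i))) = topspace (seq_topology smooth_topology)"
    and \<phi>: "\<phi> \<in> poly_map" "depends_below N \<phi>"
  shows "f N \<noteq> (\<lambda>x. \<phi> (\<lambda>i. f i x))"
proof
  assume eq: "f N = (\<lambda>x. \<phi> (\<lambda>i. f i x))"
  let ?g = "\<lambda>i (x::real). if i = N then 1 else 0 :: complex"
  have g: "?g \<in> topspace (seq_topology smooth_topology)"
  proof -
    have "(\<lambda>x. if i = N then 1 else 0 :: complex) \<in> smooth_funs" for i by (rule smooth_const)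
    then show ?thesis by (simp add: PiE_UNIV_domain topspace_smooth_topology)
  qed
  have "?g N = (\<lambda>x. \<phi> (\<lambda>i. ?g i x))"
  proof (rule forall_in_closure_of_eq[where f = "\<lambda>g. g N" and g = "\<lambda>g x. \<phi> (\<lambda>i. g i x)"])
    show "?g \<in> seq_topology smooth_topology closure_of (range (\<lambda>n i. (T ^^ n) (f i)))" using g orbit by simp
    show "Hausdorff_space (smooth_topology :: (real \<Rightarrow> complex) topology)"
      by (intro metrizable_imp_Hausdorff_space completely_metrizable_imp_metrizable_space completely_metrizable_smooth_topology)
    show "continuous_map (seq_topology smooth_topology) smooth_topology (\<lambda>g. g N)"
      by (rule continuous_map_product_projection) simp
    show "continuous_map (seq_topology smooth_topology) smooth_topology (\<lambda>g x. \<phi> (\<lambda>i. g i x))"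
      by (rule continuous_map_poly_map[OF \<phi>(1)])
    fix g assume "g \<in> range (\<lambda>n i. (T ^^ n) (f i))"
    then obtain n where "g = (\<lambda>i. (T ^^ n) (f i))" by blast
    then show "g N = (\<lambda>x. \<phi> (\<lambda>i. g i x))"
      using arg_cong[OF eq, of "T ^^ n"] by (simp add: poly_map_funpow[OF T f \<phi>(1)])
  qed
  then have "(1::complex) = \<phi> (\<lambda>i. ?g i 0)" by (auto dest: fun_cong)
  also have "\<dots> = \<phi> (\<lambda>i. 0)" using \<phi>(2) unfolding depends_below_def by force
  also have "\<dots> = 0" by (rule poly_map_zero[OF \<phi>(1)])
  finally show False by simp
qed

text \<open>
  Finitely many elements of the generated algebra involve only variables with index below some \<open>N\<close>, and the subalgebra
  of such elements misses the generator \<open>f N\<close>.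
\<close>

lemma dense_hypercyclic_algebra:
  fixes T :: "(real \<Rightarrow> complex) \<Rightarrow> (real \<Rightarrow> complex)"
  assumes T: "multiplicative_operator UNIV smooth_topology T" and pt: "pairwise_transitive smooth_topology T"
  shows "\<exists>A. hypercyclic_algebra UNIV smooth_topology T A \<and>
             smooth_topology closure_of A = topspace smooth_topology \<and>
             \<not> finitely_generated_subalgebra UNIV smooth_topology A"
proof -
  let ?X = "smooth_topology :: (real \<Rightarrow> complex) topology"
  obtain D where D: "countable D" "?X closure_of D = topspace ?X" by (rule separable_smooth_topology)
  have ne: "topspace ?X \<noteq> {}" using smooth_const[of "0::complex"] unfolding topspace_smooth_topology by blast
  have cT: "continuous_map ?X ?X T" using T by (simp add: multiplicative_operator_def operator_on_def)
  obtain f where dense: "?X closure_of (range f) = topspace ?X" and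
    fY: "f \<in> topspace (seq_topology ?X)" and
    orbit: "seq_topology ?X closure_of (range (\<lambda>n i. (T ^^ n) (f i))) = topspace (seq_topology ?X)"
    by (rule dense_orbit_in_sequence_space[OF completely_metrizable_smooth_topology ne D cT pt])
  have f: "f i \<in> smooth_funs" for i using fY by (auto simp: PiE_UNIV_domain topspace_smooth_topology)
  let ?A = "generated_algebra f poly_map"
  have fA: "f i \<in> ?A" for i
    unfolding generated_algebra_def using poly_map.coord[of i] by force
  have sub: "fun_subalgebra UNIV ?X ?A" by (rule fun_subalgebra_generated_all[OF f])
  have Adense: "?X closure_of ?A = topspace ?X"
    using closure_of_mono[of "range f" ?A ?X] dense closure_of_subset_topspace[of ?X ?A] fA by blast
  have fne: "f i \<noteq> (\<lambda>x. 0)" for i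
    using generator_not_in_previous[OF T f orbit poly_map.zero, of i] by (simp add: depends_below_def)
  have "hypercyclic_algebra UNIV ?X T ?A"
    unfolding hypercyclic_algebra_def
  proof (intro conjI ballI impI sub)
    show "?A \<noteq> {\<lambda>x. 0}" using fA[of 0] fne[of 0] by auto
    show "hypercyclic_vector ?X T v" if "v \<in> ?A" "v \<noteq> (\<lambda>x. 0)" for v
      using that poly_map_hypercyclic[OF T f orbit] unfolding generated_algebra_def by blast
  qed
  moreover have "\<not> finitely_generated_subalgebra UNIV ?X ?A"
  proof
    assume "finitely_generated_subalgebra UNIV ?X ?A"
    then obtain S where S: "finite S" "S \<subseteq> ?A" "fun_subalgebra UNIV ?X hull S = ?A"
      unfolding finitely_generated_subalgebra_def by blast
    let ?A' = "\<lambda>N. generated_algebra f {\<phi> \<in> poly_map. depends_below N \<phi>}"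
    have "\<exists>N. S \<subseteq> ?A' N"
      using S(1,2)
    proof (induction rule: finite_induct)
      case (insert s S)
      then obtain N where N: "S \<subseteq> ?A' N" by blast
      obtain \<phi> where \<phi>: "\<phi> \<in> poly_map" "s = (\<lambda>x. \<phi> (\<lambda>i. f i x))"
        using insert.prems unfolding generated_algebra_def by blast
      obtain M where M: "depends_below M \<phi>" using poly_map_depends_below[OF \<phi>(1)] by blast
      have "s \<in> ?A' (max M N)" using \<phi> depends_below_mono[OF M, of "max M N"] by (auto simp: generated_algebra_def)
      moreover have "?A' N \<subseteq> ?A' (max M N)"
        using depends_below_mono[of N _ "max M N"] unfolding generated_algebra_def by (intro image_mono) auto
      ultimately show ?case using N by (intro exI[of _ "max M N"]) blast
    qed simp
    then obtain N where N: "S \<subseteq> ?A' N" by blast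
    then have "fun_subalgebra UNIV ?X hull S \<subseteq> ?A' N"
      by (intro hull_minimal fun_subalgebra_generated_below[OF f])
    then have "f N \<in> ?A' N" using fA[of N] S(3) by blast
    then show False using generator_not_in_previous[OF T f orbit] unfolding generated_algebra_def by blast
  qed
  ultimately show ?thesis using Adense by blast
qed

text \<open>
  An open set contains, with any function, its sums with small constants.
\<close>

lemma infinite_smooth_open:
  fixes V :: "(real \<Rightarrow> complex) set"
  assumes "openin smooth_topology V" "V \<noteq> {}"
  shows "infinite V"
proof -
  obtain g n e where g: "g \<in> smooth_funs" "0 < e" "smooth_nbhd n e g \<subseteq> V"
    using assms unfolding openin_smooth_topology by blast
  let ?F = "\<lambda>c x. g x + complex_of_real c"
  have "?F c \<in> V" if "c \<in> {0..e}" for c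
  proof -
    have "?F c \<in> smooth_nbhd n e g"
      using that g(1) by (auto simp: smooth_nbhd_def smooth_add deriv_bound_def nth_deriv_const)
    then show ?thesis using g(3) by blast
  qed
  moreover have "inj_on ?F {0..e}" by (rule inj_onI) (metis add_left_cancel of_real_eq_iff)
  moreover have "infinite {0..e}" using g(2) by (rule infinite_Icc)
  ultimately show ?thesis by (meson finite_imageD finite_subset image_subset_iff)
qed

text \<open>
  The orbit of a hypercyclic pair \<open>(u, v)\<close> meets \<open>U \<times> U'\<close> at some time \<open>n\<close>. To meet \<open>V \<times> V'\<close> at a time that
  is not earlier, delete from \<open>V\<close> the finitely many points \<open>T\<^sup>k u\<close> with \<open>k < n\<close>; the rest is nonempty because
  the space has no isolated points.
\<close>

lemma weakly_mixing_imp_pairwise_transitive: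
  fixes T :: "(real \<Rightarrow> complex) \<Rightarrow> (real \<Rightarrow> complex)"
  assumes "weakly_mixing smooth_topology T"
  shows "pairwise_transitive smooth_topology T"
  unfolding pairwise_transitive_def
proof (intro allI impI, elim conjE)
  let ?X = "smooth_topology :: (real \<Rightarrow> complex) topology"
  fix U V U' V' assume U: "openin ?X U" "U \<noteq> {}" and V: "openin ?X V" "V \<noteq> {}"
    and U': "openin ?X U'" "U' \<noteq> {}" and V': "openin ?X V'" "V' \<noteq> {}"
  obtain w where w: "hypercyclic_vector (prod_topology ?X ?X) (map_prod T T) w"
    using assms unfolding weakly_mixing_def hypercyclic_def by blast
  obtain u v where uv: "w = (u, v)" by (cases w)
  have pow: "(map_prod T T ^^ n) w = ((T ^^ n) u, (T ^^ n) v)" for n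
    unfolding uv by (induction n) auto
  have hit: "\<exists>n. (T ^^ n) u \<in> A \<and> (T ^^ n) v \<in> B"
    if A: "openin ?X A" "A \<noteq> {}" and B: "openin ?X B" "B \<noteq> {}" for A B
  proof -
    have "openin (prod_topology ?X ?X) (A \<times> B)" "A \<times> B \<noteq> {}" using A B by (auto simp: openin_prod_Times_iff)
    then have "range (\<lambda>n. (map_prod T T ^^ n) w) \<inter> (A \<times> B) \<noteq> {}"
      using w unfolding hypercyclic_vector_def dense_intersects_open by blast
    then show ?thesis by (auto simp: pow)
  qed
  obtain n where n: "(T ^^ n) u \<in> U" "(T ^^ n) v \<in> U'" using hit[OF U U'] by blast
  let ?F = "(\<lambda>k. (T ^^ k) u) ` {..<n}"
  have op: "openin ?X (V - ?F \<inter> topspace ?X)"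
  proof (intro openin_diff V)
    have "t1_space ?X"
      by (intro Hausdorff_imp_t1_space metrizable_imp_Hausdorff_space
          completely_metrizable_imp_metrizable_space completely_metrizable_smooth_topology)
    then show "closedin ?X (?F \<inter> topspace ?X)"
      unfolding t1_space_closedin_finite by auto
  qed
  have "finite (?F \<inter> topspace ?X)" by simp
  then have "\<not> V \<subseteq> ?F \<inter> topspace ?X" using infinite_smooth_open[OF V] finite_subset by blast
  then have ne: "V - ?F \<inter> topspace ?X \<noteq> {}" by blast
  obtain m where m: "(T ^^ m) u \<in> V - ?F \<inter> topspace ?X" "(T ^^ m) v \<in> V'"
    using hit[OF op ne V'] by blast
  have "n \<le> m"
  proof (rule ccontr)
    assume "\<not> n \<le> m"
    then have "(T ^^ m) u \<in> ?F" by auto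
    then show False using m(1) openin_subset[OF V(1)] by blast
  qed
  then have "(T ^^ (m - n)) ((T ^^ n) y) = (T ^^ m) y" for y
    by (metis comp_apply funpow_add le_add_diff_inverse2)
  then have "(T ^^ (m - n)) ((T ^^ n) u) \<in> V" "(T ^^ (m - n)) ((T ^^ n) v) \<in> V'"
    using m by simp_all
  then show "\<exists>k. hits T k U V \<and> hits T k U' V'"
    unfolding hits_def using n by blast
qed

lemma multiplicative_operator_translation:
  "multiplicative_operator UNIV (smooth_topology :: (real \<Rightarrow> complex) topology) (translation a)"
proof -
  let ?X = "smooth_topology :: (real \<Rightarrow> complex) topology"
  have "continuous_map ?X ?X (translation a)"
    unfolding continuous_map_def
  proof (intro conjI allI impI)
    show "translation a \<in> topspace ?X \<rightarrow> topspace ?X" by (simp add: topspace_smooth_topology smooth_translation)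
    fix U assume U: "openin ?X U"
    show "openin ?X {f \<in> topspace ?X. translation a f \<in> U}"
      unfolding openin_smooth_topology
    proof (intro conjI ballI)
      fix f assume "f \<in> {f \<in> topspace ?X. translation a f \<in> U}"
      then have f: "f \<in> smooth_funs" "translation a f \<in> U" by (auto simp: topspace_smooth_topology)
      obtain n e where ne: "0 < e" "smooth_nbhd n e (translation a f) \<subseteq> U"
        using U f(2) unfolding openin_smooth_topology by blast
      obtain m :: nat where m: "real n + \<bar>a\<bar> \<le> real m" using real_arch_simple by blast
      have "translation a g \<in> smooth_nbhd n e (translation a f)" if g: "g \<in> smooth_nbhd m e f" for g
      proof -
        have gs: "g \<in> smooth_funs" "deriv_bound m m (\<lambda>x. g x - f x) e" using g by (auto simp: smooth_nbhd_def)
        have nm: "n \<le> m" using m by linarith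
        have "norm (nth_deriv i (translation a (\<lambda>x. g x - f x)) x) \<le> e" if "i \<le> n" "\<bar>x\<bar> \<le> real n" for i x
        proof -
          have "\<bar>x + a\<bar> \<le> real m" using that(2) m by linarith
          then have "norm (nth_deriv i (\<lambda>x. g x - f x) (x + a)) \<le> e"
            using gs(2) that(1) nm by (simp add: deriv_bound_def)
          then show ?thesis
            unfolding nth_deriv_translation[OF smooth_diff[OF gs(1) f(1)]] by (simp add: translation_def)
        qed
        moreover have "translation a (\<lambda>x. g x - f x) = (\<lambda>x. translation a g x - translation a f x)"
          by (simp add: translation_def)
        ultimately show ?thesis
          unfolding smooth_nbhd_def deriv_bound_def using smooth_translation[OF gs(1)] by simp
      qed
      then show "\<exists>n. \<exists>e>0. smooth_nbhd n e f \<subseteq> {f \<in> topspace ?X. translation a f \<in> U}"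
        using ne by (intro exI[of _ m] exI[of _ e]) (auto simp: topspace_smooth_topology smooth_nbhd_def)
    qed (auto simp: topspace_smooth_topology)
  qed
  then show ?thesis
    unfolding multiplicative_operator_def operator_on_def by (simp add: translation_def)
qed

lemma pairwise_transitive_translation:
  assumes "a \<noteq> 0"
  shows "pairwise_transitive (smooth_topology :: (real \<Rightarrow> complex) topology) (translation a)"
  unfolding pairwise_transitive_def hits_def
proof (intro allI impI, elim conjE)
  let ?X = "smooth_topology :: (real \<Rightarrow> complex) topology"
  fix U V U' V' assume U: "openin ?X U" "U \<noteq> {}" and V: "openin ?X V" "V \<noteq> {}"
    and U': "openin ?X U'" "U' \<noteq> {}" and V': "openin ?X V'" "V' \<noteq> {}"
  obtain M where "\<And>n. n \<ge> M \<Longrightarrow> \<exists>f\<in>U. (translation a ^^ n) f \<in> V"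
    using translation_mixing[OF assms U V] by blast
  moreover obtain N where "\<And>n. n \<ge> N \<Longrightarrow> \<exists>f\<in>U'. (translation a ^^ n) f \<in> V'"
    using translation_mixing[OF assms U' V'] by blast
  ultimately show "\<exists>n. (\<exists>f\<in>U. (translation a ^^ n) f \<in> V) \<and> (\<exists>f\<in>U'. (translation a ^^ n) f \<in> V')"
    by (intro exI[of _ "max M N"]) simp
qed

theorem corollary1p7:
  shows
    "(\<forall>T. multiplicative_operator (UNIV :: complex set) smooth_topology T \<and>
          weakly_mixing smooth_topology T \<longrightarrow>
        (\<exists>A. hypercyclic_algebra UNIV smooth_topology T A \<and>
             smooth_topology closure_of A = topspace smooth_topology \<and>
             \<not> finitely_generated_subalgebra UNIV smooth_topology A)) \<and>
     (\<forall>a::real. a \<noteq> 0 \<longrightarrow>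
        (\<exists>A. hypercyclic_algebra (UNIV :: complex set) smooth_topology (translation a) A \<and>
             smooth_topology closure_of A = topspace smooth_topology \<and>
             \<not> finitely_generated_subalgebra UNIV smooth_topology A)) \<and>
     (\<forall>\<Omega> T. open \<Omega> \<and> \<Omega> \<noteq> {} \<and> connected \<Omega> \<and> simply_connected \<Omega> \<and>
          multiplicative_operator (UNIV :: complex set) (hol_topology \<Omega>) T \<longrightarrow>
        \<not> (\<exists>A. hypercyclic_algebra UNIV (hol_topology \<Omega>) T A)) \<and>
     (\<forall>T. multiplicative_operator (UNIV :: real set) smooth_topology T \<longrightarrow>
        \<not> (\<exists>A. hypercyclic_algebra UNIV smooth_topology T A)) \<and>
     (\<forall>T. multiplicative_operator (\<real> :: complex set) real_entire_topology T \<longrightarrow>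
        \<not> (\<exists>A. hypercyclic_algebra \<real> real_entire_topology T A))"
proof (intro conjI allI impI notI; (elim conjE exE)?)
  fix T :: "(real \<Rightarrow> complex) \<Rightarrow> real \<Rightarrow> complex"
  assume "multiplicative_operator UNIV smooth_topology T" "weakly_mixing smooth_topology T"
  then show "\<exists>A. hypercyclic_algebra UNIV smooth_topology T A \<and>
      smooth_topology closure_of A = topspace smooth_topology \<and>
      \<not> finitely_generated_subalgebra UNIV smooth_topology A"
    by (intro dense_hypercyclic_algebra weakly_mixing_imp_pairwise_transitive)
next
  fix a :: real assume "a \<noteq> 0"
  then show "\<exists>A. hypercyclic_algebra (UNIV :: complex set) smooth_topology (translation a) A \<and>
      smooth_topology closure_of A = topspace smooth_topology \<and>
      \<not> finitely_generated_subalgebra UNIV smooth_topology A"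
    by (intro dense_hypercyclic_algebra multiplicative_operator_translation pairwise_transitive_translation)
next
  fix \<Omega> T A
  assume "open \<Omega>" "\<Omega> \<noteq> {}" "multiplicative_operator UNIV (hol_topology \<Omega>) T"
    "hypercyclic_algebra UNIV (hol_topology \<Omega>) T A"
  then show False using hol_no_hypercyclic_algebra by blast
next
  fix T and A :: "(real \<Rightarrow> real) set"
  assume "multiplicative_operator UNIV smooth_topology T" "hypercyclic_algebra UNIV smooth_topology T A"
  then show False using smooth_real_no_hypercyclic_algebra by blast
next
  fix T A
  assume "multiplicative_operator \<real> real_entire_topology T" "hypercyclic_algebra \<real> real_entire_topology T A"
  then show False using real_entire_no_hypercyclic_algebra by blast
qed

end
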